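(* Let $\theta\in\{1,\epsilon\}$, $\beta\in k^\times$, $X^*=\beta\cdot\sqrt\theta\in\mathfrak t_\theta^*$, and let $s,\theta'\in k^\times$, $Y=s\cdot\sqrt{\theta'}\in\mathfrak t_{\theta'}$. If $\operatorname{depth}(X^* )+\operatorname{depth}(Y)\le0$ and $X^*$ and $Y$ lie in a common (split or unramified) torus $\mathbf T$ (with $T=\mathbf T(k)$), then $$M^G_{X^*}(Y)=q^{-(r+1)}|D_{\mathfrak g}(Y)|^{-1/2}\,\gamma_\Phi(X^*,Y)\sum_{\sigma\in W(G,T)}\Phi(\langle\mathrm{Ad}^*(\sigma)X^*,Y\rangle).$$
   Context: $k$ is a non-discrete non-Archimedean local field of residual characteristic $\ne 2$, with ring of integers $\mathcal O$, maximal ideal $\mathfrak p$, valuation $\operatorname{ord}$ with value group $\mathbb Z$, residue field of order $q$, $|x|=q^{-\operatorname{ord}(x)}$. $\epsilon\in\mathcal O^\times$ is a lift of a non-square of the residue field. $dx$ (or $dt$) is the Haar measure on $k$ giving $\mathcal O$ measure $1$, and $d^\times x=|x|^{-1}dx$. $\Phi$ is a non-trivial additive character of $k$. For $\theta\in k^\times$, $k_\theta=k\oplus k\sqrt\theta$ is the $k$-algebra $k[x]/(x^2-\theta)$, $N_\theta(a+b\sqrt\theta)=a^2-b^2\theta$; $\operatorname{sgn}_\epsilon(x)=(-1)^{\operatorname{ord}(x)}$. $G=\mathrm{SL}_2(k)$, $\mathfrak g=\mathfrak{sl}_2(k)$ with dual $\mathfrak g^*$ and pairing $\langle\cdot,\cdot\rangle$.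 $\mathbf T_\theta=\{\begin{pmatrix}a&b\\ b\theta&a\end{pmatrix}:a^2-b^2\theta=1\}$, with Lie algebra $\mathfrak t_\theta=k\cdot\sqrt\theta$, where here $\sqrt\theta$ denotes the matrix $\begin{pmatrix}0&1\\ \theta&0\end{pmatrix}$. $X^*=\beta\sqrt\theta$ means the functional $Z\mapsto\mathrm{Tr}(\beta\sqrt\theta Z)$ on $\mathfrak g$. $X^*$ and $Y$ lie in a common torus if their centralisers $\mathbf T_\theta$ and $\mathbf T_{\theta'}$ are equal. $W(G,T)=N_G(T)/T$. $D_{\mathfrak g}\begin{pmatrix}a&b\\c&-a\end{pmatrix}=4(a^2+bc)$. Depth: $\operatorname{depth}(c\sqrt\theta)=\tfrac12\operatorname{ord}(c^2\theta)$ for $c\sqrt\theta\in\mathfrak t_\theta$; $\operatorname{depth}(X^* )$ is the largest real $\rho$ such that $\Phi(\langle X^*,Z\rangle)=1$ for all $Z\in\mathfrak t_\theta$ with $\operatorname{depth}(Z)>-\rho$. Put $r=-\operatorname{depth}(X^* )$ (an integer here). For $\theta=\theta'\in\{1,\epsilon\}$: $\gamma_\Phi(X^*,Y)=1$ if $\theta=1$ and $\gamma_\Phi(X^*,Y)=(-1)^{r+1}\operatorname{sgn}_\epsilon(s)$ if $\theta=\epsilon$. Mock Fourier transform: $$M^G_{X^*}(Y)=\sum_{n\in\mathbb Z}\int_{\operatorname{ord}(x)=n}\mathbf 1_{N_\theta(k_\theta^\times)}(x)\Bigl(\sum_{l\in\mathbb Z}\int_{\operatorname{ord}(t)=l}\Phi\bigl(\beta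 s(x\theta'+x^{-1}\theta-x^{-1}t^2)\bigr)\,dt\Bigr)d^\times x,$$ where $\mathbf 1_S$ is the characteristic function of $S$. *)

theory Defs
  imports "HOL-Analysis.Analysis" "HOL-Algebra.QuotRing" "HOL-Algebra.Group_Action"
begin

section \<open>Non-Archimedean local fields\<close>

text \<open>
  The valuation is a function \<open>ord :: 'k \<Rightarrow> int\<close> whose value at \<open>0\<close> is irrelevant:
  every definition below treats \<open>0\<close> separately, so that \<open>ord 0 = \<infinity>\<close> in effect.
\<close>

definition val_ring :: "('k::field \<Rightarrow> int) \<Rightarrow> 'k ring" where
  "val_ring ord = \<lparr>carrier = {x. x = 0 \<or> 0 \<le> ord x}, monoid.mult = (*), one = 1, zero = 0, add = (+)\<rparr>"

definition max_ideal :: "('k::field \<Rightarrow> int) \<Rightarrow> 'k set" where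
  "max_ideal ord = {x. x = 0 \<or> 1 \<le> ord x}"

definition residue_field :: "('k::field \<Rightarrow> int) \<Rightarrow> 'k set ring" where
  "residue_field ord = val_ring ord Quot max_ideal ord"

definition residue_card :: "('k::field \<Rightarrow> int) \<Rightarrow> nat" where
  "residue_card ord = card (carrier (residue_field ord))"

definition nabs :: "('k::field \<Rightarrow> int) \<Rightarrow> 'k \<Rightarrow> real" where
  "nabs ord x = (if x = 0 then 0 else real (residue_card ord) powi (- ord x))"

definition shell :: "('k::field \<Rightarrow> int) \<Rightarrow> int \<Rightarrow> 'k set" where
  "shell ord n = {x. x \<noteq> 0 \<and> ord x = n}"

text \<open>
  A complete discretely valued field with value group \<open>\<int>\<close>, finite residue field and odd residual
  characteristic.  The metric (hence the topology and the Borel sets) of the type is the one given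
  by the normalised absolute value; completeness is part of the class \<open>complete_space\<close>.
\<close>

locale local_field =
  fixes ord :: "'k::{field, complete_space} \<Rightarrow> int"
  assumes ord_mult: "x \<noteq> 0 \<Longrightarrow> y \<noteq> 0 \<Longrightarrow> ord (x * y) = ord x + ord y"
    and ord_add: "x \<noteq> 0 \<Longrightarrow> y \<noteq> 0 \<Longrightarrow> x + y \<noteq> 0 \<Longrightarrow> min (ord x) (ord y) \<le> ord (x + y)"
    and ord_surj: "\<exists>x. x \<noteq> 0 \<and> ord x = n"
    and finite_residue_field: "finite (carrier (residue_field ord))"
    and odd_residue_char:
      "\<one>\<^bsub>residue_field ord\<^esub> \<oplus>\<^bsub>residue_field ord\<^esub> \<one>\<^bsub>residue_field ord\<^esub> \<noteq> \<zero>\<^bsub>residue_field ord\<^esub>"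
    and dist_nabs: "dist x y = nabs ord (x - y)"

definition nonsquare_unit_lift :: "('k::field \<Rightarrow> int) \<Rightarrow> 'k \<Rightarrow> bool" where
  "nonsquare_unit_lift ord \<epsilon> \<longleftrightarrow> \<epsilon> \<in> shell ord 0 \<and>
     \<not> (\<exists>u \<in> carrier (residue_field ord).
          u \<otimes>\<^bsub>residue_field ord\<^esub> u = max_ideal ord +>\<^bsub>val_ring ord\<^esub> \<epsilon>)"

definition normalised_haar :: "('k::{field, complete_space} \<Rightarrow> int) \<Rightarrow> 'k measure \<Rightarrow> bool" where
  "normalised_haar ord \<mu> \<longleftrightarrow> sets \<mu> = sets borel \<and>
     (\<forall>a. \<forall>A \<in> sets borel. emeasure \<mu> ((+) a ` A) = emeasure \<mu> A) \<and>
     emeasure \<mu> (carrier (val_ring ord)) = 1"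

definition mult_haar :: "('k::field \<Rightarrow> int) \<Rightarrow> 'k measure \<Rightarrow> 'k measure" where
  "mult_haar ord \<mu> = density \<mu> (\<lambda>x. ennreal (inverse (nabs ord x)))"

definition additive_character :: "('k::{field, complete_space} \<Rightarrow> complex) \<Rightarrow> bool" where
  "additive_character \<Phi> \<longleftrightarrow> continuous_on UNIV \<Phi> \<and>
     (\<forall>x y. \<Phi> (x + y) = \<Phi> x * \<Phi> y) \<and> (\<forall>x. cmod (\<Phi> x) = 1)"

section \<open>The algebras \<open>k[x]/(x\<^sup>2 - \<theta>)\<close>\<close>

text \<open>The pair \<open>(a, b)\<close> stands for \<open>a + b\<surd>\<theta>\<close>.\<close>

definition quad_alg :: "'k::field \<Rightarrow> ('k \<times> 'k) ring" where
  "quad_alg \<theta> = \<lparr>carrier = UNIV,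
     monoid.mult = (\<lambda>(a, b) (c, d). (a * c + b * d * \<theta>, a * d + b * c)), one = (1, 0),
     zero = (0, 0), add = (\<lambda>(a, b) (c, d). (a + c, b + d))\<rparr>"

definition quad_norm :: "'k::field \<Rightarrow> 'k \<times> 'k \<Rightarrow> 'k" where
  "quad_norm \<theta> = (\<lambda>(a, b). a\<^sup>2 - b\<^sup>2 * \<theta>)"

definition norm_group :: "'k::field \<Rightarrow> 'k set" where
  "norm_group \<theta> = quad_norm \<theta> ` Units (quad_alg \<theta>)"

section \<open>\<open>SL\<^sub>2\<close>, tori and Weyl groups\<close>

definition SL2 :: "('k::field ^ 2 ^ 2) monoid" where
  "SL2 = \<lparr>carrier = {A. det A = 1}, monoid.mult = (**), one = mat 1\<rparr>"

definition mat2 :: "'k::field \<Rightarrow> 'k \<Rightarrow> 'k \<Rightarrow> 'k \<Rightarrow> 'k ^ 2 ^ 2" where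
  "mat2 a b c d = vector [vector [a, b], vector [c, d]]"

definition torus :: "'k::field \<Rightarrow> ('k ^ 2 ^ 2) set" where
  "torus \<theta> = {mat2 a b (b * \<theta>) a | a b. a\<^sup>2 - b\<^sup>2 * \<theta> = 1}"

text \<open>The matrix \<open>c\<surd>\<theta>\<close>, where \<open>\<surd>\<theta>\<close> is the matrix with rows \<open>(0, 1)\<close> and \<open>(\<theta>, 0)\<close>.\<close>

definition lie_elt :: "'k::field \<Rightarrow> 'k \<Rightarrow> 'k ^ 2 ^ 2" where
  "lie_elt c \<theta> = mat2 0 c (c * \<theta>) 0"

definition lie_torus :: "'k::field \<Rightarrow> ('k ^ 2 ^ 2) set" where
  "lie_torus \<theta> = {lie_elt c \<theta> | c. True}"

text \<open>Elements of the dual of the Lie algebra are represented by functionals on all \<open>2 \<times> 2\<close>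
  matrices, and are evaluated only at matrices of trace zero.\<close>

definition dual_of :: "'k::field ^ 2 ^ 2 \<Rightarrow> 'k ^ 2 ^ 2 \<Rightarrow> 'k" where
  "dual_of X = (\<lambda>Z. trace (X ** Z))"

definition coadjoint :: "'k::field ^ 2 ^ 2 \<Rightarrow> ('k ^ 2 ^ 2 \<Rightarrow> 'k) \<Rightarrow> 'k ^ 2 ^ 2 \<Rightarrow> 'k" where
  "coadjoint g X = (\<lambda>Z. X (inv\<^bsub>SL2\<^esub> g ** Z ** g))"

definition weyl_group :: "('k::field ^ 2 ^ 2) set \<Rightarrow> ('k ^ 2 ^ 2) set monoid" where
  "weyl_group T = (SL2\<lparr>carrier := normalizer SL2 T\<rparr>) Mod T"

text \<open>Action of an element of the Weyl group, which is a coset of \<open>T\<close>, on functionals fixed by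
  \<open>T\<close>; for those it does not depend on the representative.\<close>

definition weyl_coadjoint ::
    "('k::field ^ 2 ^ 2) set \<Rightarrow> ('k ^ 2 ^ 2 \<Rightarrow> 'k) \<Rightarrow> 'k ^ 2 ^ 2 \<Rightarrow> 'k" where
  "weyl_coadjoint \<sigma> X = coadjoint (SOME g. g \<in> \<sigma>) X"

definition disc :: "'k::field ^ 2 ^ 2 \<Rightarrow> 'k" where
  "disc Z = 4 * ((Z $ 1 $ 1)\<^sup>2 + Z $ 1 $ 2 * Z $ 2 $ 1)"

section \<open>Depth\<close>

text \<open>The coefficient \<open>c\<close> of \<open>Z = c\<surd>\<theta>\<close> is the upper right entry of \<open>Z\<close>.\<close>

definition depth :: "('k::field \<Rightarrow> int) \<Rightarrow> 'k \<Rightarrow> 'k ^ 2 ^ 2 \<Rightarrow> ereal" where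
  "depth ord \<theta> Z = (let c = Z $ 1 $ 2 in
     if c = 0 then \<infinity> else ereal (real_of_int (ord (c\<^sup>2 * \<theta>)) / 2))"

definition dual_depth ::
    "('k::field \<Rightarrow> int) \<Rightarrow> ('k \<Rightarrow> complex) \<Rightarrow> 'k \<Rightarrow> ('k ^ 2 ^ 2 \<Rightarrow> 'k) \<Rightarrow> real" where
  "dual_depth ord \<Phi> \<theta> X =
     (GREATEST \<rho>. \<forall>Z \<in> lie_torus \<theta>. ereal (- \<rho>) < depth ord \<theta> Z \<longrightarrow> \<Phi> (X Z) = 1)"

section \<open>The sign and the mock Fourier transform\<close>

definition sgn_unram :: "('k::field \<Rightarrow> int) \<Rightarrow> 'k \<Rightarrow> complex" where
  "sgn_unram ord x = (-1) powi (ord x)"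

text \<open>
  The factor \<open>\<gamma>\<^sub>\<Phi>(X, Y)\<close> for a functional \<open>X\<close> on the torus of \<open>\<theta>\<close> and \<open>Y = s\<surd>\<theta>\<close>, where \<open>\<theta>\<close> is \<open>1\<close> or
  a non-square unit; \<open>r\<close> stands for the opposite of the depth of \<open>X\<close>.  In these cases that depth is
  an integer, so the floor only converts its type.
\<close>

definition gamma_factor ::
    "('k::field \<Rightarrow> int) \<Rightarrow> ('k \<Rightarrow> complex) \<Rightarrow> 'k \<Rightarrow> ('k ^ 2 ^ 2 \<Rightarrow> 'k) \<Rightarrow> 'k ^ 2 ^ 2 \<Rightarrow> complex" where
  "gamma_factor ord \<Phi> \<theta> X Y =
     (let r = - dual_depth ord \<Phi> \<theta> X; s = Y $ 1 $ 2 in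
      if \<theta> = 1 then 1 else (-1) powi (\<lfloor>r\<rfloor> + 1) * sgn_unram ord s)"

text \<open>For \<open>X = \<beta>\<surd>\<theta>\<close> (as a functional) and \<open>Y = s\<surd>\<theta>'\<close>.\<close>

definition mock_fourier ::
    "('k::{field, complete_space} \<Rightarrow> int) \<Rightarrow> 'k measure \<Rightarrow> ('k \<Rightarrow> complex) \<Rightarrow>
     'k \<Rightarrow> 'k \<Rightarrow> 'k \<Rightarrow> 'k \<Rightarrow> complex" where
  "mock_fourier ord \<mu> \<Phi> \<beta> \<theta> s \<theta>' =
     (\<Sum>\<^sub>\<infinity>n\<in>UNIV. LINT x : shell ord n | mult_haar ord \<mu>.
        indicator (norm_group \<theta>) x *
        (\<Sum>\<^sub>\<infinity>l\<in>UNIV. LINT t : shell ord l | \<mu>.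
           \<Phi> (\<beta> * s * (x * \<theta>' + inverse x * \<theta> - inverse x * t\<^sup>2))))"

end

theory Submission
  imports Defs
begin

text \<open>
  Let \<open>c = \<beta>s\<close>, let \<open>\<pp> d\<close> be the largest fractional ideal on which \<open>\<Phi>\<close> is trivial and put
  \<open>m = d - ord c\<close>; the depth hypothesis says \<open>m \<ge> 1\<close>.  On a shell \<open>ord x = n\<close> with \<open>n \<noteq> 0\<close> one of
  \<open>x\<close>, \<open>x\<^sup>-\<^sup>1\<close> dominates, and averaging over a suitable coset kills the integral.  On the units the inner sum
  is the Gauss integral \<open>g(a) = \<integral> \<Phi>(a t\<^sup>2) dt\<close> over \<open>\<pp> 0\<close> with \<open>a = -c/x\<close>, and \<open>g(\<theta>a) = \<gamma> g(a)\<close>.  Writing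
  \<open>x = y/\<theta>\<close> and \<open>t = w + y\<close> (the trick that evaluates Salie sums) turns the exponent
  \<open>c(y + \<theta>\<^sup>2/y - t\<^sup>2/y)\<close> into \<open>c(\<theta>\<^sup>2 - w\<^sup>2)/y - 2cw\<close>.  Summing over the units \<open>y\<close> localises \<open>w\<close> at
  \<open>w\<^sup>2 \<equiv> \<theta>\<^sup>2\<close> modulo \<open>\<pp> m\<close>, that is at \<open>w \<equiv> \<plusminus>\<theta>\<close>, which gives \<open>\<gamma> q\<^sup>-\<^sup>m (\<Phi>(2c\<theta>) + \<Phi>(-2c\<theta>))\<close>.  The two terms
  correspond to the two elements of the Weyl group.  Its non-trivial element is rational because
  \<open>-1\<close>, being a unit, is a norm.
\<close>

section \<open>Fractional ideals and the residue field\<close>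

text \<open>The measure is known only through its invariance and its value on the integers, so
  integrals are computed as finite sums: a function constant on cosets of some
  \<open>\<pp> n\<close> is summed over representatives, and the interchange of the sum over units
  with the integral over \<open>w\<close> is a finite one. On the outer shells nothing is evaluated:
  averaging over translates needs only that the norm indicator and the inner sum do not change under
  the translation, and it asks for no measurability of the inner sum. The Gauss integral is never
  computed when d - ord a is odd. Only the ratio g(\<theta>a)/g(a) matters, since x = y/\<theta>
  puts \<theta> inside g and the shift t = w + y absorbs what remains into a phase linear in 1/y.
  Thus \<theta> = 1 and \<theta> = \<epsilon> are treated together, with \<gamma> = 1 or (-1)^m. The
  constants match because r + 1 = d - ord \<beta> and |D(Y)|^(-1/2) = q^(ord s): the prefactor is
  q^(-m), and the sign (-1)^(r+1) sgn(s) is (-1)^m.\<close>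

context local_field
begin

text \<open>The fractional ideals: index 0 gives the ring of integers, index 1 its maximal ideal.
  Zero is put in by hand because \<open>ord 0\<close> is arbitrary; membership in
  \<open>\<pp> n\<close> thus expresses a lower bound on the valuation without case
  distinctions.\<close>

definition \<pp> :: "int \<Rightarrow> 'k set" where
  "\<pp> n = {x. x = 0 \<or> n \<le> ord x}"

lemma pp_0 [simp]: "0 \<in> \<pp> n"
  by (simp add: \<pp>_def)

lemma pp_iff: "x \<noteq> 0 \<Longrightarrow> x \<in> \<pp> n \<longleftrightarrow> n \<le> ord x"
  by (simp add: \<pp>_def)

lemma pp_mono: "x \<in> \<pp> n \<Longrightarrow> m \<le> n \<Longrightarrow> x \<in> \<pp> m"
  by (auto simp: \<pp>_def)

lemma ord_1 [simp]: "ord 1 = 0"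
  using ord_mult[of 1 1] by simp

lemma ord_minus [simp]: "ord (- x) = ord x"
proof (cases "x = 0")
  case False
  have "ord (-1) = 0" using ord_mult[of "-1" "-1"] by simp
  thus ?thesis using ord_mult[of "-1" x] False by simp
qed simp

lemma ord_inverse [simp]: "x \<noteq> 0 \<Longrightarrow> ord (inverse x) = - ord x"
  using ord_mult[of x "inverse x"] by simp

lemma ord_divide: "x \<noteq> 0 \<Longrightarrow> y \<noteq> 0 \<Longrightarrow> ord (x / y) = ord x - ord y"
  by (simp add: divide_inverse ord_mult)

lemma ord_power2: "x \<noteq> 0 \<Longrightarrow> ord (x\<^sup>2) = 2 * ord x"
  by (simp add: power2_eq_square ord_mult)

lemma pp_add: "x \<in> \<pp> n \<Longrightarrow> y \<in> \<pp> n \<Longrightarrow> x + y \<in> \<pp> n"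
  using ord_add[of x y] by (cases "x = 0 \<or> y = 0 \<or> x + y = 0") (auto simp: \<pp>_def)

lemma pp_minus_iff [simp]: "- x \<in> \<pp> n \<longleftrightarrow> x \<in> \<pp> n"
  by (simp add: \<pp>_def)

lemma pp_diff: "x \<in> \<pp> n \<Longrightarrow> y \<in> \<pp> n \<Longrightarrow> x - y \<in> \<pp> n"
  using pp_add[of x n "-y"] by simp

lemma pp_diff_commute: "x - y \<in> \<pp> n \<longleftrightarrow> y - x \<in> \<pp> n"
  using pp_minus_iff[of "x - y" n] by simp

lemma pp_add_cancel: "y \<in> \<pp> n \<Longrightarrow> x + y \<in> \<pp> n \<longleftrightarrow> x \<in> \<pp> n"
  using pp_add[of x n y] pp_diff[of "x + y" n y] by auto

lemma pp_trans: "x - y \<in> \<pp> n \<Longrightarrow> y - z \<in> \<pp> n \<Longrightarrow> x - z \<in> \<pp> n"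
  using pp_add[of "x - y" n "y - z"] by simp

lemma pp_trans': "x - z \<in> \<pp> n \<Longrightarrow> y - z \<in> \<pp> n \<Longrightarrow> x - y \<in> \<pp> n"
  using pp_diff[of "x - z" n "y - z"] by simp

lemma pp_mult: "x \<in> \<pp> m \<Longrightarrow> y \<in> \<pp> n \<Longrightarrow> x * y \<in> \<pp> (m + n)"
  by (cases "x = 0 \<or> y = 0") (auto simp: \<pp>_def ord_mult)

lemma pp_mult_mono: "x \<in> \<pp> m \<Longrightarrow> y \<in> \<pp> n \<Longrightarrow> k \<le> m + n \<Longrightarrow> x * y \<in> \<pp> k"
  using pp_mult pp_mono by blast

lemma pp_mult_left_iff: "x \<noteq> 0 \<Longrightarrow> x * y \<in> \<pp> n \<longleftrightarrow> y \<in> \<pp> (n - ord x)"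
  by (cases "y = 0") (auto simp: \<pp>_def ord_mult)

lemma ord_add_eq:
  assumes "x \<noteq> 0" "y \<in> \<pp> (ord x + 1)"
  shows "x + y \<noteq> 0" "ord (x + y) = ord x"
proof -
  show nz: "x + y \<noteq> 0"
    using assms by (auto simp: \<pp>_def add_eq_0_iff)
  show "ord (x + y) = ord x"
  proof (cases "y = 0")
    case False
    hence y: "ord y \<ge> ord x + 1" using assms by (simp add: \<pp>_def)
    have "ord x \<le> ord (x + y)" using ord_add[of x y] False assms nz y by auto
    \<comment> \<open>The ultrametric inequality for x = (x + y) - y; since ord y > ord x, the
      minimum must be ord (x + y).\<close>
    moreover have "min (ord (x + y)) (ord y) \<le> ord x"
      using ord_add[of "x + y" "-y"] False assms nz by simp
    ultimately show ?thesis using y by auto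
  qed simp
qed

lemma shell_iff: "x \<in> shell ord n \<longleftrightarrow> x \<in> \<pp> n \<and> x \<notin> \<pp> (n + 1)"
  by (auto simp: shell_def \<pp>_def)

lemma shell_add_iff: "h \<in> \<pp> K \<Longrightarrow> n < K \<Longrightarrow> x + h \<in> shell ord n \<longleftrightarrow> x \<in> shell ord n"
  using pp_mono[of h K n] pp_mono[of h K "n+1"] by (simp add: shell_iff pp_add_cancel)

section \<open>The residue field in terms of cosets of the maximal ideal\<close>

lemma val_ring_sel [simp]:
  "carrier (val_ring ord) = \<pp> 0" "x \<otimes>\<^bsub>val_ring ord\<^esub> y = x * y" "\<one>\<^bsub>val_ring ord\<^esub> = 1"
  "x \<oplus>\<^bsub>val_ring ord\<^esub> y = x + y"
  by (auto simp: val_ring_def \<pp>_def)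

lemma max_ideal_eq: "max_ideal ord = \<pp> 1"
  by (simp add: max_ideal_def \<pp>_def)

lemma residue_coset: "max_ideal ord +>\<^bsub>val_ring ord\<^esub> x = {y. y - x \<in> \<pp> 1}"
proof (intro equalityI subsetI)
  fix y assume "y \<in> {y. y - x \<in> \<pp> 1}"
  thus "y \<in> max_ideal ord +>\<^bsub>val_ring ord\<^esub> x"
    unfolding a_r_coset_def' max_ideal_eq by (auto intro!: bexI[of _ "y - x"])
qed (auto simp: a_r_coset_def' max_ideal_eq)

lemma carrier_residue_field:
  "carrier (residue_field ord) = (\<lambda>x. {y. y - x \<in> \<pp> 1}) ` \<pp> 0"
  by (auto simp: residue_field_def FactRing_def A_RCOSETS_def' residue_coset)

lemma coset_eq_iff: "{y. y - x \<in> \<pp> n} = {y. y - z \<in> \<pp> n} \<longleftrightarrow> x - z \<in> \<pp> n"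
proof
  assume "{y. y - x \<in> \<pp> n} = {y. y - z \<in> \<pp> n}"
  hence "x \<in> {y. y - z \<in> \<pp> n}" by (metis (mono_tags) diff_self mem_Collect_eq pp_0)
  thus "x - z \<in> \<pp> n" by simp
next
  assume "x - z \<in> \<pp> n"
  thus "{y. y - x \<in> \<pp> n} = {y. y - z \<in> \<pp> n}"
    using pp_trans pp_diff_commute by blast
qed

text \<open>Brings the assumption on the residual characteristic down from the quotient ring: if 2
  lay in the maximal ideal, the coset of 1 added to itself would be the maximal ideal, which is the
  zero of the quotient.\<close>

lemma two_unit: "(2::'k) \<noteq> 0" "ord 2 = 0"
proof -
  have "2 \<notin> \<pp> 1"
  proof
    assume 2: "2 \<in> \<pp> 1"
    have "\<one>\<^bsub>residue_field ord\<^esub> \<oplus>\<^bsub>residue_field ord\<^esub> \<one>\<^bsub>residue_field ord\<^esub> =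
      {y. y - 1 \<in> \<pp> 1} <+>\<^bsub>val_ring ord\<^esub> {y. y - 1 \<in> \<pp> 1}"
      by (simp add: residue_field_def FactRing_def residue_coset)
    also have "\<dots> = \<pp> 1"
    proof (intro equalityI subsetI)
      fix z assume "z \<in> {y. y - 1 \<in> \<pp> 1} <+>\<^bsub>val_ring ord\<^esub> {y. y - 1 \<in> \<pp> 1}"
      then obtain u w where "z = u + w" "u - 1 \<in> \<pp> 1" "w - 1 \<in> \<pp> 1"
        by (auto simp: set_add_def')
      hence "z - 2 \<in> \<pp> 1" using pp_add[of "u - 1" 1 "w - 1"] by (simp add: algebra_simps)
      thus "z \<in> \<pp> 1" using pp_add[OF _ 2, of "z - 2"] by simp
    next
      fix z assume "z \<in> \<pp> 1"
      hence "(z - 1) - 1 \<in> \<pp> 1" using pp_diff[OF _ 2, of z] by simp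
      thus "z \<in> {y. y - 1 \<in> \<pp> 1} <+>\<^bsub>val_ring ord\<^esub> {y. y - 1 \<in> \<pp> 1}"
        unfolding set_add_def' by (intro UN_I[of "z - 1"] UN_I[of 1]) auto
    qed
    also have "\<dots> = \<zero>\<^bsub>residue_field ord\<^esub>"
      by (simp add: residue_field_def FactRing_def max_ideal_eq)
    finally show False using odd_residue_char by simp
  qed
  thus "(2::'k) \<noteq> 0" by (metis pp_0)
  have "(1::'k) + 1 \<in> \<pp> 0" by (intro pp_add) (auto simp: \<pp>_def)
  thus "ord 2 = 0" using \<open>2 \<notin> \<pp> 1\<close> by (auto simp: \<pp>_def)
qed

abbreviation q :: nat where "q \<equiv> residue_card ord"

lemma q_ge_2: "q \<ge> 2"
proof -
  have "1 - 0 \<notin> \<pp> 1" by (simp add: pp_iff)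
  hence "card {{y. y - 1 \<in> \<pp> 1}, {y. y - 0 \<in> \<pp> 1}} = 2"
    using coset_eq_iff[of 1 1 0] by simp
  moreover have "{{y. y - 1 \<in> \<pp> 1}, {y. y - 0 \<in> \<pp> 1}} \<subseteq> carrier (residue_field ord)"
  proof -
    have "1 \<in> \<pp> 0" by (simp add: pp_iff)
    thus ?thesis unfolding carrier_residue_field using pp_0[of 0] by blast
  qed
  ultimately show ?thesis unfolding residue_card_def
    by (metis card_mono finite_residue_field)
qed

text \<open>The last conclusion is the non-square condition stated with elements instead of cosets:
  if u^2 were congruent to e, the coset of u would square to the coset of e.\<close>

lemma nonsquare_unit_liftD:
  assumes "nonsquare_unit_lift ord e"
  shows "e \<noteq> 0" "ord e = 0" "u \<in> \<pp> 0 \<Longrightarrow> u\<^sup>2 - e \<notin> \<pp> 1"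
proof -
  show "e \<noteq> 0" and "ord e = 0" using assms by (auto simp: nonsquare_unit_lift_def shell_def)
  assume u: "u \<in> \<pp> 0"
  show "u\<^sup>2 - e \<notin> \<pp> 1"
  proof
    assume e: "u\<^sup>2 - e \<in> \<pp> 1"
    \<comment> \<open>The product of cosets is a union over all pairs of representatives, so
      independence of the representatives has to be part of the claim.\<close>
    have *: "{y. y - a * b \<in> \<pp> 1} = {y. y - e \<in> \<pp> 1}" if "a - u \<in> \<pp> 1" "b - u \<in> \<pp> 1" for a b
    proof -
      have "a \<in> \<pp> 0" using pp_add[OF pp_mono[OF that(1), of 0] u] by simp
      have "a * (b - u) + (a - u) * u \<in> \<pp> 1"
        by (intro pp_add pp_mult_mono[OF \<open>a \<in> \<pp> 0\<close> that(2)] pp_mult_mono[OF that(1) u]) auto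
      hence "a * b - u\<^sup>2 \<in> \<pp> 1" by (simp add: algebra_simps power2_eq_square)
      from pp_trans[OF this e] show ?thesis by (simp add: coset_eq_iff)
    qed
    let ?U = "{y. y - u \<in> \<pp> 1}"
    have "?U \<in> carrier (residue_field ord)" using u by (auto simp: carrier_residue_field)
    moreover have "?U \<otimes>\<^bsub>residue_field ord\<^esub> ?U = (\<Union>a\<in>?U. \<Union>b\<in>?U. {y. y - a * b \<in> \<pp> 1})"
      by (simp add: residue_field_def FactRing_def rcoset_mult_def residue_coset)
    moreover have "\<dots> = {y. y - e \<in> \<pp> 1}"
    proof (intro equalityI subsetI)
      fix z assume "z \<in> (\<Union>a\<in>?U. \<Union>b\<in>?U. {y. y - a * b \<in> \<pp> 1})"
      then obtain a b where "a - u \<in> \<pp> 1" "b - u \<in> \<pp> 1" and z: "z \<in> {y. y - a * b \<in> \<pp> 1}"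
        by blast
      from *[OF this(1,2)] z show "z \<in> {y. y - e \<in> \<pp> 1}" by (rule equalityD1[THEN subsetD])
    next
      fix z assume "z \<in> {y. y - e \<in> \<pp> 1}"
      hence "z \<in> {y. y - u * u \<in> \<pp> 1}" using *[of u u] by (simp only: diff_self pp_0 simp_thms)
      thus "z \<in> (\<Union>a\<in>?U. \<Union>b\<in>?U. {y. y - a * b \<in> \<pp> 1})"
        by (intro UN_I[of u]) (simp_all only: diff_self pp_0 mem_Collect_eq)
    qed
    ultimately show False
      using assms unfolding nonsquare_unit_lift_def residue_coset by metis
  qed
qed

lemma ex_ord: obtains x where "x \<noteq> 0" "ord x = n"
  using ord_surj by blast

section \<open>Balls, square roots of principal units and norm groups\<close>

lemma q_powi_le_iff: "real q powi i \<le> real q powi j \<longleftrightarrow> i \<le> j"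
proof -
  have "real q > 1" using q_ge_2 by simp
  thus ?thesis
    using power_int_increasing[of i j "real q"] power_int_strict_increasing[of j i "real q"] by linarith
qed

lemma pp_eq_cball: "\<pp> n = cball 0 (real q powi - n)"
proof -
  have "x \<in> \<pp> n \<longleftrightarrow> dist 0 x \<le> real q powi - n" for x
    by (cases "x = 0") (simp_all add: \<pp>_def dist_nabs nabs_def q_powi_le_iff)
  thus ?thesis by (simp only: set_eq_iff mem_cball simp_thms)
qed

lemma closed_pp: "closed (\<pp> n)"
  by (simp add: pp_eq_cball)

lemma dist_translate: "dist (a + x) (a + y) = dist x (y::'k)"
  by (simp add: dist_nabs)

text \<open>A case of Hensel's lemma by the Banach fixed point theorem: (1 + z)^2 = 1 + u says z =
  (u - z^2)/2, and this map contracts the complete set \<open>\<pp> 1\<close> by at least 1/q,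
  because f x - f y = (y - x)(x + y)/2 with x + y in the maximal ideal.\<close>

lemma principal_unit_is_square:
  assumes u: "u \<in> \<pp> 1"
  obtains z where "(1 + z)\<^sup>2 = 1 + u" "z \<in> \<pp> 1"
proof -
  note [simp] = two_unit
  let ?f = "\<lambda>z. (u - z\<^sup>2) / 2"
  have 2: "x / 2 \<in> \<pp> n \<longleftrightarrow> x \<in> \<pp> n" for x :: 'k and n
    using pp_mult_left_iff[of "1 / 2" x n] ord_divide[of 1 2] by simp
  have "\<exists>!z. z \<in> \<pp> 1 \<and> ?f z = z"
  proof (rule Banach_fix[where c = "1 / 2"])
    show "complete (\<pp> 1)" using closed_pp complete_eq_closed by blast
    show "?f ` \<pp> 1 \<subseteq> \<pp> 1"
    proof clarify
      fix z assume "z \<in> \<pp> 1"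
      hence "z * z \<in> \<pp> 1" by (intro pp_mult_mono[of z 1 z 1]) auto
      thus "?f z \<in> \<pp> 1" by (simp only: 2 power2_eq_square pp_diff u)
    qed
    fix x y assume xy: "x \<in> \<pp> 1" "y \<in> \<pp> 1"
    show "dist (?f x) (?f y) \<le> 1 / 2 * dist x y"
    \<comment> \<open>In these degenerate cases f x = f y; elsewhere both factors are non-zero, so
      their valuations are meaningful.\<close>
    proof (cases "x = y \<or> x + y = 0")
      case True
      thus ?thesis by (auto simp: add_eq_0_iff)
    next
      case False
      have eq: "?f x - ?f y = (y - x) * (x + y) / 2"
        by (simp add: diff_divide_distrib[symmetric] power2_eq_square algebra_simps)
      have "ord (?f x - ?f y) = ord (x - y) + ord (x + y)" "?f x - ?f y \<noteq> 0"
        unfolding eq using False ord_minus[of "x - y"] by (auto simp: ord_divide ord_mult)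
      moreover have "1 \<le> ord (x + y)" using pp_add[OF xy] False by (simp add: pp_iff)
      ultimately have "dist (?f x) (?f y) \<le> real q powi (- ord (x - y) - 1)"
        by (auto simp: dist_nabs nabs_def q_powi_le_iff)
      also have "\<dots> = dist x y / q" using q_ge_2 False by (simp add: dist_nabs nabs_def power_int_diff)
      also have "\<dots> \<le> dist x y / 2" by (rule divide_left_mono) (use q_ge_2 in auto)
      finally show ?thesis by simp
    qed
  next
    show "\<pp> 1 \<noteq> {}" using pp_0[of 1] by blast
  qed auto
  then obtain z where "z \<in> \<pp> 1" "?f z = z" by blast
  hence "u - z\<^sup>2 = 2 * z" by (simp add: divide_eq_eq mult.commute)
  hence "(1 + z)\<^sup>2 = 1 + u" by (simp add: power2_eq_square algebra_simps)
  thus ?thesis using that \<open>z \<in> \<pp> 1\<close> by blast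
qed

text \<open>An element of non-zero norm is automatically a unit of the algebra, with inverse its
  conjugate divided by the norm. This holds in the split algebra as well.\<close>

lemma norm_group_iff:
  fixes x \<theta> :: 'k
  assumes "x \<noteq> 0"
  shows "x \<in> norm_group \<theta> \<longleftrightarrow> (\<exists>a b. x = a\<^sup>2 - b\<^sup>2 * \<theta>)"
proof
  assume "x \<in> norm_group \<theta>"
  thus "\<exists>a b. x = a\<^sup>2 - b\<^sup>2 * \<theta>" by (auto simp: norm_group_def quad_norm_def)
next
  assume "\<exists>a b. x = a\<^sup>2 - b\<^sup>2 * \<theta>"
  then obtain a b where x: "x = a\<^sup>2 - b\<^sup>2 * \<theta>" by blast
  have "a * (a / x) - b * (b / x) * \<theta> = (a\<^sup>2 - b\<^sup>2 * \<theta>) / x"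
    by (simp add: power2_eq_square diff_divide_distrib)
  hence 1: "a * (a / x) - b * (b / x) * \<theta> = 1" "a * (- b / x) + b * (a / x) = 0"
    using assms by (simp_all add: x[symmetric])
  have "(a, b) \<in> Units (quad_alg \<theta>)"
    unfolding Units_def using 1
    by (intro CollectI conjI bexI[of _ "(a / x, - b / x)"]) (simp_all add: quad_alg_def algebra_simps)
  thus "x \<in> norm_group \<theta>"
    by (force simp: norm_group_def quad_norm_def x)
qed

lemma norm_group_square_mult:
  fixes x y \<theta> :: 'k
  assumes "x \<noteq> 0" "y \<noteq> 0" "x \<in> norm_group \<theta>"
  shows "x * y\<^sup>2 \<in> norm_group \<theta>"
proof -
  obtain a b where x: "x = a\<^sup>2 - b\<^sup>2 * \<theta>" using assms norm_group_iff by blast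
  have "x * y\<^sup>2 = (a * y)\<^sup>2 - (b * y)\<^sup>2 * \<theta>"
    unfolding x by (simp add: power_mult_distrib algebra_simps)
  hence "\<exists>a b. x * y\<^sup>2 = a\<^sup>2 - b\<^sup>2 * \<theta>" by blast
  thus ?thesis using assms norm_group_iff[of "x * y\<^sup>2" \<theta>] by simp
qed

lemma norm_group_principal_unit_mult:
  assumes "x \<noteq> 0" "u \<in> \<pp> 1" "x \<in> norm_group \<theta>"
  shows "x * (1 + u) \<in> norm_group \<theta>"
proof -
  obtain z where z: "(1 + z)\<^sup>2 = 1 + u" "z \<in> \<pp> 1" using principal_unit_is_square[OF assms(2)] .
  have "1 + z \<noteq> 0" using ord_add_eq(1)[of 1 z] z by simp
  thus ?thesis using norm_group_square_mult[OF assms(1) _ assms(3)] z by metis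
qed

text \<open>Local constancy of the norm indicator: x + h = x(1 + h/x), and the principal unit 1 +
  h/x is a square. The converse is the same statement for x + h and -h, as ord (x + h) = ord
  x.\<close>

lemma norm_group_add_iff:
  assumes "x \<noteq> 0" "h \<in> \<pp> (ord x + 1)"
  shows "x + h \<in> norm_group \<theta> \<longleftrightarrow> x \<in> norm_group \<theta>"
proof -
  have *: "x + h \<in> norm_group \<theta>"
    if "x \<noteq> 0" "h \<in> \<pp> (ord x + 1)" "x \<in> norm_group \<theta>" for x h
    using norm_group_principal_unit_mult[of x "inverse x * h" \<theta>] that
    by (simp add: pp_mult_left_iff add.commute distrib_left mult.assoc[symmetric])
  show ?thesis using *[OF assms] *[of "x + h" "- h"] ord_add_eq[OF assms] assms by auto
qed

end

section \<open>Transversals and the Haar measure\<close>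

context local_field
begin

definition saturated :: "int \<Rightarrow> 'k set \<Rightarrow> bool" where
  "saturated n A \<longleftrightarrow> (\<forall>x\<in>A. \<forall>y. y - x \<in> \<pp> n \<longrightarrow> y \<in> A)"

text \<open>Only points of \<open>A\<close> are compared, so that functions involving 1/x can be
  periodic on a shell without being periodic everywhere.\<close>

definition periodic_on :: "int \<Rightarrow> 'k set \<Rightarrow> ('k \<Rightarrow> complex) \<Rightarrow> bool" where
  "periodic_on n A f \<longleftrightarrow> (\<forall>x\<in>A. \<forall>y\<in>A. x - y \<in> \<pp> n \<longrightarrow> f x = f y)"

definition transversal :: "int \<Rightarrow> 'k set \<Rightarrow> 'k set \<Rightarrow> bool" where
  "transversal n A T \<longleftrightarrow> finite T \<and> T \<subseteq> A \<and> (\<forall>x\<in>A. \<exists>!t. t \<in> T \<and> x - t \<in> \<pp> n)"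

lemma saturatedD: "saturated n A \<Longrightarrow> x \<in> A \<Longrightarrow> y - x \<in> \<pp> n \<Longrightarrow> y \<in> A"
  unfolding saturated_def by blast

lemma saturated_mono: "saturated k A \<Longrightarrow> k \<le> n \<Longrightarrow> saturated n A"
  unfolding saturated_def using pp_mono by blast

lemma saturated_pp: "m \<le> n \<Longrightarrow> saturated n (\<pp> m)"
  unfolding saturated_def using pp_add pp_mono by (metis diff_add_cancel)

lemma saturated_shell: "m < n \<Longrightarrow> saturated n (shell ord m)"
  unfolding saturated_def using shell_add_iff by (metis add.commute diff_add_cancel)

lemma transversal_finite: "transversal n A T \<Longrightarrow> finite T"
  by (simp add: transversal_def)

lemma transversal_subset: "transversal n A T \<Longrightarrow> t \<in> T \<Longrightarrow> t \<in> A"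
  by (auto simp: transversal_def)

lemma transversal_obtain:
  assumes "transversal n A T" "x \<in> A"
  obtains t where "t \<in> T" "x - t \<in> \<pp> n"
  using assms unfolding transversal_def by blast

lemma transversal_unique:
  assumes "transversal n A T" "s \<in> T" "t \<in> T" "s - t \<in> \<pp> n"
  shows "s = t"
proof -
  have "s \<in> A" using assms by (auto simp: transversal_def)
  hence "\<exists>!t. t \<in> T \<and> s - t \<in> \<pp> n" using assms(1) unfolding transversal_def by blast
  moreover have "s - s \<in> \<pp> n" by simp
  ultimately show ?thesis using assms by blast
qed

lemma transversalI:
  assumes "finite T" "T \<subseteq> A" "\<And>x. x \<in> A \<Longrightarrow> \<exists>t\<in>T. x - t \<in> \<pp> n"
    "\<And>s t. s \<in> T \<Longrightarrow> t \<in> T \<Longrightarrow> s - t \<in> \<pp> n \<Longrightarrow> s = t"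
  shows "transversal n A T"
  unfolding transversal_def
proof (intro conjI ballI)
  fix x assume "x \<in> A"
  then obtain t where t: "t \<in> T" "x - t \<in> \<pp> n" using assms(3) by blast
  show "\<exists>!t. t \<in> T \<and> x - t \<in> \<pp> n"
  proof (rule ex1I[of _ t])
    fix s assume "s \<in> T \<and> x - s \<in> \<pp> n"
    hence "s \<in> T" "s - t \<in> \<pp> n" using pp_trans[of s x n t] t pp_diff_commute by blast+
    thus "s = t" using assms(4) t by blast
  qed (use t in simp)
qed (use assms in auto)

lemma transversal_scale:
  assumes T: "transversal n A T" and "c \<noteq> 0"
  shows "transversal (n + ord c) ((*) c ` A) ((*) c ` T)" "card ((*) c ` T) = card T"
proof -
  have *: "c * x - c * y \<in> \<pp> (n + ord c) \<longleftrightarrow> x - y \<in> \<pp> n" for x y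
    using pp_mult_left_iff[OF assms(2), of "x - y" "n + ord c"] by (simp add: right_diff_distrib)
  show "transversal (n + ord c) ((*) c ` A) ((*) c ` T)"
  proof (rule transversalI)
    fix x assume "x \<in> (*) c ` A"
    then obtain y where y: "y \<in> A" "x = c * y" by blast
    obtain t where "t \<in> T" "y - t \<in> \<pp> n" using transversal_obtain[OF T y(1)] .
    thus "\<exists>t\<in>(*) c ` T. x - t \<in> \<pp> (n + ord c)"
      using * y by (intro bexI[of _ "c * t"] imageI) simp_all
  next
    fix s t assume "s \<in> (*) c ` T" "t \<in> (*) c ` T" "s - t \<in> \<pp> (n + ord c)"
    then obtain x y where "s = c * x" "t = c * y" "x \<in> T" "y \<in> T" "x - y \<in> \<pp> n" using * by auto
    thus "s = t" using transversal_unique[OF T] by blast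
  qed (use transversal_finite[OF T] transversal_subset[OF T] in auto)
  show "card ((*) c ` T) = card T" using assms(2) by (intro card_image inj_onI) simp
qed

lemma pp_scale: "c \<noteq> 0 \<Longrightarrow> (*) c ` \<pp> n = \<pp> (n + ord c)"
proof (intro equalityI subsetI)
  fix x assume c: "c \<noteq> 0" "x \<in> \<pp> (n + ord c)"
  hence "x / c \<in> \<pp> n" using pp_mult_left_iff[of c "x / c" "n + ord c"] by simp
  thus "x \<in> (*) c ` \<pp> n" using c by (intro image_eqI[of _ _ "x / c"]) simp_all
qed (auto simp: pp_mult_left_iff)

text \<open>A substitution rule for sums over cosets. The point g t need not lie in
  \<open>T\<close>, so it is replaced by its representative \<open>\<rho> t\<close>; injectivity
  modulo \<open>\<pp> n\<close> makes \<open>\<rho>\<close> an injection of a finite set into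
  itself, hence a permutation, and periodicity absorbs the replacement.\<close>

lemma transversal_sum_reindex:
  assumes T: "transversal n A T" and f: "periodic_on n A f"
    and g: "\<And>x. x \<in> A \<Longrightarrow> g x \<in> A"
    and inj: "\<And>x y. x \<in> A \<Longrightarrow> y \<in> A \<Longrightarrow> g x - g y \<in> \<pp> n \<Longrightarrow> x - y \<in> \<pp> n"
  shows "(\<Sum>t\<in>T. f (g t)) = (\<Sum>t\<in>T. f t)"
proof -
  define \<rho> where "\<rho> x = (SOME t. t \<in> T \<and> g x - t \<in> \<pp> n)" for x
  have \<rho>: "\<rho> x \<in> T" "g x - \<rho> x \<in> \<pp> n" if "x \<in> A" for x
    using someI_ex[of "\<lambda>t. t \<in> T \<and> g x - t \<in> \<pp> n"] transversal_obtain[OF T g[OF that]]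
    unfolding \<rho>_def by metis+
  have TA: "t \<in> A" if "t \<in> T" for t using transversal_subset[OF T that] .
  have "inj_on \<rho> T"
  proof (rule inj_onI)
    fix s t assume st: "s \<in> T" "t \<in> T" "\<rho> s = \<rho> t"
    hence "g s - g t \<in> \<pp> n"
      using pp_trans[of "g s" "\<rho> s" n "g t"] \<rho>(2)[OF TA, of s] \<rho>(2)[OF TA, of t] pp_diff_commute by metis
    thus "s = t" using inj[OF TA TA] transversal_unique[OF T] st by blast
  qed
  moreover have "\<rho> ` T \<subseteq> T" using \<rho>(1) TA by blast
  ultimately have bij: "bij_betw \<rho> T T"
    using endo_inj_surj[OF transversal_finite[OF T]] by (simp add: bij_betw_def)
  have "(\<Sum>t\<in>T. f (g t)) = (\<Sum>t\<in>T. f (\<rho> t))"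
    using f \<rho> g TA unfolding periodic_on_def by (intro sum.cong) blast+
  also have "\<dots> = (\<Sum>t\<in>T. f t)" by (rule sum.reindex_bij_betw[OF bij])
  finally show ?thesis .
qed

text \<open>One representative is chosen in each residue class, and multiplication by an element of
  valuation n carries the case 0 to the case n.\<close>

lemma ex_transversal_step: "\<exists>T. transversal (n + 1) (\<pp> n) T \<and> card T = q"
proof -
  define \<rho> where "\<rho> C = (SOME x. x \<in> \<pp> 0 \<and> C = {y. y - x \<in> \<pp> 1})" for C
  have \<rho>: "\<rho> C \<in> \<pp> 0" "C = {y. y - \<rho> C \<in> \<pp> 1}" if "C \<in> carrier (residue_field ord)" for C
    using that someI_ex[of "\<lambda>x. x \<in> \<pp> 0 \<and> C = {y. y - x \<in> \<pp> 1}"]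
    unfolding carrier_residue_field image_iff Bex_def \<rho>_def by blast+
  let ?T = "\<rho> ` carrier (residue_field ord)"
  have inj: "inj_on \<rho> (carrier (residue_field ord))"
  proof (rule inj_onI)
    fix C D assume "C \<in> carrier (residue_field ord)" "D \<in> carrier (residue_field ord)" "\<rho> C = \<rho> D"
    thus "C = D" using \<rho>(2)[of C] \<rho>(2)[of D] by (simp only:)
  qed
  have T: "transversal 1 (\<pp> 0) ?T"
  proof (rule transversalI)
    fix x assume x: "x \<in> \<pp> 0"
    let ?C = "{y. y - x \<in> \<pp> 1}"
    have C: "?C \<in> carrier (residue_field ord)" using x by (simp add: carrier_residue_field)
    have "x \<in> {y. y - \<rho> ?C \<in> \<pp> 1}" using \<rho>(2)[OF C] by (metis (mono_tags, lifting) diff_self mem_Collect_eq pp_0)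
    thus "\<exists>t\<in>?T. x - t \<in> \<pp> 1" using C by blast
  next
    fix s t assume "s \<in> ?T" "t \<in> ?T" and st: "s - t \<in> \<pp> 1"
    then obtain C D where CD: "C \<in> carrier (residue_field ord)" "D \<in> carrier (residue_field ord)"
      "s = \<rho> C" "t = \<rho> D" by blast
    have "C = D" using \<rho>(2)[OF CD(1)] \<rho>(2)[OF CD(2)] coset_eq_iff[of s 1 t] st CD(3,4) by metis
    thus "s = t" using CD by simp
  qed (use finite_residue_field \<rho> in auto)
  obtain c where c: "c \<noteq> 0" "ord c = n" using ex_ord .
  have "card ?T = q" unfolding residue_card_def by (rule card_image[OF inj])
  thus ?thesis
    using transversal_scale[OF T c(1)] pp_scale[OF c(1), of 0] c(2) by (metis add.commute add_0)
qed

end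

section \<open>Measures of cosets and integrals of periodic functions\<close>

locale haar_field = local_field ord
  for ord :: "'k::{field, complete_space} \<Rightarrow> int" +
  fixes \<mu> :: "'k measure"
  assumes haar: "normalised_haar ord \<mu>"
begin

lemma sets_mu [simp, measurable_cong]: "sets \<mu> = sets borel"
  using haar by (simp add: normalised_haar_def)

lemma space_mu [simp]: "space \<mu> = UNIV"
  using sets_eq_imp_space_eq[OF sets_mu] by simp

lemma pp_sets [measurable]: "\<pp> n \<in> sets borel"
  using closed_pp by (rule borel_closed)

lemma shell_eq_Diff: "shell ord n = \<pp> n - \<pp> (n + 1)"
  using shell_iff by blast

lemma shell_sets [measurable]: "shell ord n \<in> sets borel"
  unfolding shell_eq_Diff by measurable

lemma translate_measurable [measurable]: "(+) a \<in> borel_measurable (borel :: 'k measure)"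
proof (rule borel_measurable_continuous_onI)
  show "continuous_on UNIV ((+) a)"
    unfolding continuous_on_iff by (metis dist_translate)
qed

lemma coset_eq_translate: "{y. y - a \<in> \<pp> n} = (+) a ` \<pp> n"
proof (intro equalityI subsetI)
  fix y assume "y \<in> {y. y - a \<in> \<pp> n}"
  thus "y \<in> (+) a ` \<pp> n" by (intro image_eqI[of _ _ "y - a"]) auto
qed auto

lemma coset_eq_vimage: "{y. y - a \<in> \<pp> n} = (+) (- a) -` \<pp> n"
  by auto

lemma coset_sets [measurable]: "{y. y - a \<in> \<pp> n} \<in> sets borel"
  unfolding coset_eq_vimage using measurable_sets[OF translate_measurable pp_sets] by simp

lemma emeasure_coset: "emeasure \<mu> {y. y - a \<in> \<pp> n} = emeasure \<mu> (\<pp> n)"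
  using haar pp_sets unfolding normalised_haar_def coset_eq_translate by blast

lemma saturated_decomp:
  assumes "transversal n A T" "saturated n A"
  shows "A = (\<Union>t\<in>T. {y. y - t \<in> \<pp> n})" "disjoint_family_on (\<lambda>t. {y. y - t \<in> \<pp> n}) T"
proof -
  show "A = (\<Union>t\<in>T. {y. y - t \<in> \<pp> n})"
    using assms unfolding transversal_def saturated_def by blast
  show "disjoint_family_on (\<lambda>t. {y. y - t \<in> \<pp> n}) T"
    unfolding disjoint_family_on_def
  proof (intro ballI impI)
    fix s t assume st: "s \<in> T" "t \<in> T" "s \<noteq> t"
    have False if "y - s \<in> \<pp> n" "y - t \<in> \<pp> n" for y
      using pp_trans[of s y n t] that pp_diff_commute[of y s] transversal_unique[OF assms(1) st(1,2)] st(3)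
      by blast
    thus "{y. y - s \<in> \<pp> n} \<inter> {y. y - t \<in> \<pp> n} = {}" by blast
  qed
qed

lemma emeasure_transversal:
  assumes "transversal n A T" "saturated n A"
  shows "emeasure \<mu> A = card T * emeasure \<mu> (\<pp> n)"
proof -
  have "emeasure \<mu> A = (\<Sum>t\<in>T. emeasure \<mu> {y. y - t \<in> \<pp> n})"
    using saturated_decomp[OF assms] transversal_finite[OF assms(1)]
    by (subst sum_emeasure) auto
  thus ?thesis by (simp add: emeasure_coset)
qed

lemma emeasure_pp_step: "emeasure \<mu> (\<pp> n) = q * emeasure \<mu> (\<pp> (n + 1))"
  using ex_transversal_step[of n] emeasure_transversal saturated_pp[of n "n + 1"] by fastforce

text \<open>Each ideal consists of q translates of the next one; induction runs in both directions
  from the normalisation at index 0.\<close>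

lemma emeasure_pp: "emeasure \<mu> (\<pp> n) = ennreal (real q powi - n)"
proof -
  have q: "real q > 0" using q_ge_2 by simp
  show ?thesis
  proof (induction n rule: int_induct[where k = 0])
    case base
    show ?case using haar by (simp add: normalised_haar_def)
  next
    case (step1 i)
    have "real q powi - i = real q * real q powi - (i + 1)"
      using q power_int_add[of "real q" 1 "- (i + 1)"] by simp
    hence "ennreal q * emeasure \<mu> (\<pp> (i + 1)) = ennreal (real q * real q powi - (i + 1))"
      using emeasure_pp_step[of i] step1 by (simp only: ennreal_of_nat_eq_real_of_nat)
    also have "\<dots> = ennreal q * ennreal (real q powi - (i + 1))" using q by (simp add: ennreal_mult)
    finally show ?case using q by (simp add: ennreal_mult_cancel_left)
  next
    case (step2 i)
    have "emeasure \<mu> (\<pp> (i - 1)) = ennreal q * ennreal (real q powi - i)"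
      using emeasure_pp_step[of "i - 1"] step2 by (simp add: ennreal_of_nat_eq_real_of_nat)
    also have "\<dots> = ennreal (real q powi - (i - 1))"
      using q power_int_add[of "real q" 1 "- i"] by (simp add: ennreal_mult[symmetric])
    finally show ?case .
  qed
qed

lemma measure_pp: "measure \<mu> (\<pp> n) = real q powi - n"
  by (simp add: measure_def emeasure_pp)

text \<open>Finiteness comes from the measure: N pairwise incongruent points of \<open>A\<close>
  have disjoint cosets of measure q^(-n) inside \<open>\<pp> k\<close>, of measure q^(-k), so N is
  at most q^(n-k).\<close>

lemma ex_transversal:
  assumes A: "saturated n A" "A \<subseteq> \<pp> k" "k \<le> n"
  shows "\<exists>T. transversal n A T"
proof -
  have qpos: "real q > 0" using q_ge_2 by simp
  define \<rho> where "\<rho> x = (SOME y. y - x \<in> \<pp> n)" for x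
  have \<rho>: "\<rho> x - x \<in> \<pp> n" for x
    unfolding \<rho>_def by (rule someI[of _ x]) simp
  \<comment> \<open>Congruent points give the choice operator the same predicate, hence the same
    representative.\<close>
  have \<rho>_cong: "\<rho> x = \<rho> y" if "x - y \<in> \<pp> n" for x y
  proof -
    have "z - x \<in> \<pp> n \<longleftrightarrow> z - y \<in> \<pp> n" for z
      using pp_trans that pp_diff_commute by blast
    thus ?thesis by (simp add: \<rho>_def)
  qed
  let ?T = "\<rho> ` A"
  have TA: "?T \<subseteq> A" using A(1) \<rho> unfolding saturated_def by blast
  have inj: "s = t" if "s \<in> ?T" "t \<in> ?T" "s - t \<in> \<pp> n" for s t
  proof -
    from that(1,2) obtain x y where xy: "s = \<rho> x" "t = \<rho> y" by blast
    have "x - y \<in> \<pp> n"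
      using that(3) \<rho>[of x] \<rho>[of y] pp_trans pp_diff_commute xy by metis
    thus ?thesis using \<rho>_cong xy by blast
  qed
  have "finite ?T \<and> card ?T \<le> nat \<lceil>real q powi (n - k)\<rceil>"
  proof (rule finite_if_finite_subsets_card_bdd)
    fix F assume F: "F \<subseteq> ?T" "finite F"
    let ?A = "\<Union>t\<in>F. {y. y - t \<in> \<pp> n}"
    have sat: "saturated n ?A" unfolding saturated_def using pp_trans by blast
    have tr: "transversal n ?A F"
    proof (rule transversalI)
      show "F \<subseteq> ?A" by (auto intro!: bexI)
    next
      fix s t assume "s \<in> F" "t \<in> F" "s - t \<in> \<pp> n"
      thus "s = t" using inj F(1) by blast
    qed (use F in auto)
    have "?A \<subseteq> \<pp> k"
      using F(1) TA A(2) saturated_pp[OF A(3)] unfolding saturated_def by blast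
    hence "emeasure \<mu> ?A \<le> emeasure \<mu> (\<pp> k)" by (intro emeasure_mono) auto
    hence "ennreal (card F * real q powi - n) \<le> ennreal (real q powi - k)"
      using qpos unfolding emeasure_transversal[OF tr sat] emeasure_pp
      by (simp add: ennreal_of_nat_eq_real_of_nat ennreal_mult)
    hence "card F * real q powi - n \<le> real q powi - k"
      using qpos by (subst (asm) ennreal_le_iff) auto
    hence "card F \<le> real q powi (n - k)"
      using qpos by (simp add: power_int_diff power_int_minus field_simps)
    thus "card F \<le> nat \<lceil>real q powi (n - k)\<rceil>" by linarith
  qed
  hence "transversal n A ?T"
    using TA inj \<rho> pp_diff_commute by (intro transversalI) blast+
  thus ?thesis by blast
qed

text \<open>Cut off to \<open>A\<close>, the function is a finite combination of indicators of
  cosets, each of measure q^(-n); integrability and value are read off from that.\<close>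

lemma integral_transversal:
  assumes T: "transversal n A T" and A: "saturated n A" and f: "periodic_on n A f"
  shows "set_integrable \<mu> A f"
    "(LINT x:A|\<mu>. f x) = of_real (real q powi - n) * (\<Sum>t\<in>T. f t)"
proof -
  have eq: "indicator A x *\<^sub>R f x = (\<Sum>t\<in>T. indicator {y. y - t \<in> \<pp> n} x *\<^sub>R f t)" for x
  proof (cases "x \<in> A")
    case True
    then obtain t where t: "t \<in> T" "x - t \<in> \<pp> n" using transversal_obtain[OF T] by blast
    have "(\<Sum>s\<in>T. indicator {y. y - s \<in> \<pp> n} x *\<^sub>R f s) =
        (\<Sum>s\<in>T. if s = t then f t else 0)"
    proof (rule sum.cong)
      fix s assume s: "s \<in> T"
      have "s = t" if "x - s \<in> \<pp> n"
        using transversal_unique[OF T s t(1)] pp_trans[of s x n t] t(2) that pp_diff_commute by blast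
      hence "x - s \<in> \<pp> n \<longleftrightarrow> s = t" using t(2) by blast
      thus "indicator {y. y - s \<in> \<pp> n} x *\<^sub>R f s = (if s = t then f t else 0)"
        using t(2) by simp
    qed simp
    also have "\<dots> = f t" using t transversal_finite[OF T] by simp
    also have "\<dots> = f x" using f True t transversal_subset[OF T] unfolding periodic_on_def by metis
    finally show ?thesis using True by simp
  next
    case False
    hence "x - t \<notin> \<pp> n" if "t \<in> T" for t
      using that transversal_subset[OF T] A unfolding saturated_def by blast
    thus ?thesis using False by simp
  qed
  have "has_bochner_integral \<mu> (\<lambda>x. \<Sum>t\<in>T. indicator {y. y - t \<in> \<pp> n} x *\<^sub>R f t)
      (\<Sum>t\<in>T. measure \<mu> {y. y - t \<in> \<pp> n} *\<^sub>R f t)"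
    by (intro has_bochner_integral_sum has_bochner_integral_scaleR_left
        has_bochner_integral_real_indicator) (simp_all add: emeasure_coset emeasure_pp)
  also have "(\<Sum>t\<in>T. measure \<mu> {y. y - t \<in> \<pp> n} *\<^sub>R f t) = of_real (real q powi - n) * (\<Sum>t\<in>T. f t)"
    by (simp add: measure_def emeasure_coset emeasure_pp scaleR_conv_of_real sum_distrib_left)
  finally have "has_bochner_integral \<mu> (\<lambda>x. indicator A x *\<^sub>R f x)
      (of_real (real q powi - n) * (\<Sum>t\<in>T. f t))"
    by (simp add: eq)
  thus "set_integrable \<mu> A f" "(LINT x:A|\<mu>. f x) = of_real (real q powi - n) * (\<Sum>t\<in>T. f t)"
    unfolding set_integrable_def set_lebesgue_integral_def by (simp_all add: has_bochner_integral_iff)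
qed

section \<open>Translation invariance of integrals\<close>

lemma distr_translate: "distr \<mu> borel ((+) a) = \<mu>"
proof (rule measure_eqI)
  fix A assume "A \<in> sets (distr \<mu> borel ((+) a))"
  hence A: "A \<in> sets borel" by simp
  have eq: "(+) a -` A = (+) (- a) ` A"
  proof (intro equalityI subsetI)
    fix x assume "x \<in> (+) a -` A"
    thus "x \<in> (+) (- a) ` A" by (intro image_eqI[of _ _ "a + x"]) auto
  qed auto
  have "emeasure \<mu> ((+) (- a) ` A) = emeasure \<mu> A"
    using haar A unfolding normalised_haar_def by blast
  thus "emeasure (distr \<mu> borel ((+) a)) A = emeasure \<mu> A"
    using A by (subst emeasure_distr) (simp_all only: eq space_mu Int_UNIV_right, measurable)
qed simp

lemma
  fixes f :: "'k \<Rightarrow> complex"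
  assumes "integrable \<mu> f"
  shows integrable_translate: "integrable \<mu> (\<lambda>x. f (x + h))"
    and integral_translate_integrable: "(\<integral>x. f (x + h) \<partial>\<mu>) = (\<integral>x. f x \<partial>\<mu>)"
proof -
  have f: "f \<in> borel_measurable borel" using assms by (simp add: borel_measurable_integrable measurable_cong_sets[OF sets_mu refl, symmetric])
  have i: "integrable (distr \<mu> borel ((+) h)) f" using assms by (simp add: distr_translate)
  show "integrable \<mu> (\<lambda>x. f (x + h))"
    using integrable_distr[OF _ i] by (simp add: add.commute)
  show "(\<integral>x. f (x + h) \<partial>\<mu>) = (\<integral>x. f x \<partial>\<mu>)"
    using integral_distr[OF _ f, of "(+) h" \<mu>] by (simp add: distr_translate add.commute)
qed

text \<open>Translating back shows that non-integrability is also invariant, and then both sides are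
  the default value 0.\<close>

lemma integral_translate:
  fixes f :: "'k \<Rightarrow> complex"
  shows "(\<integral>x. f (x + h) \<partial>\<mu>) = (\<integral>x. f x \<partial>\<mu>)"
proof (cases "integrable \<mu> f")
  case False
  have "\<not> integrable \<mu> (\<lambda>x. f (x + h))"
    using integrable_translate[of "\<lambda>x. f (x + h)" "- h"] False by auto
  thus ?thesis using False by (simp add: not_integrable_integral_eq)
qed (rule integral_translate_integrable)

lemma set_integral_translate:
  fixes f :: "'k \<Rightarrow> complex"
  assumes "\<And>x. x + h \<in> A \<longleftrightarrow> x \<in> A"
  shows "(LINT x:A|\<mu>. f (x + h)) = (LINT x:A|\<mu>. f x)"
  using integral_translate[of "\<lambda>x. indicator A x *\<^sub>R f x" h] assms
  by (simp add: set_lebesgue_integral_def indicator_def)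

text \<open>If \<open>f\<close> is not integrable, its Bochner integral is \<open>0\<close> by convention.\<close>

lemma integral_eq_0_if_average_eq_0:
  fixes f :: "'k \<Rightarrow> complex"
  assumes H: "finite H" "H \<noteq> {}" and f: "\<And>x. (\<Sum>h\<in>H. f (x + h)) = 0"
  shows "(\<integral>x. f x \<partial>\<mu>) = 0"
proof (cases "integrable \<mu> f")
  case True
  have "of_nat (card H) * (\<integral>x. f x \<partial>\<mu>) = (\<Sum>h\<in>H. \<integral>x. f (x + h) \<partial>\<mu>)"
    by (simp add: integral_translate)
  also have "\<dots> = (\<integral>x. (\<Sum>h\<in>H. f (x + h)) \<partial>\<mu>)"
    using integrable_translate[OF True] by (intro Bochner_Integration.integral_sum[symmetric])
  also have "\<dots> = 0" by (simp add: f)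
  finally show ?thesis using H by simp
qed (rule not_integrable_integral_eq)

end

section \<open>Squares and norms modulo the maximal ideal\<close>

context local_field
begin

lemma pp_prime:
  assumes "x \<in> \<pp> 0" "y \<in> \<pp> 0" "x * y \<in> \<pp> 1"
  shows "x \<in> \<pp> 1 \<or> y \<in> \<pp> 1"
  using assms by (cases "x = 0 \<or> y = 0") (auto simp: \<pp>_def ord_mult)

lemma pp_square: "x \<in> \<pp> 0 \<Longrightarrow> x\<^sup>2 \<in> \<pp> 0"
  using pp_mult[of x 0 x 0] by (simp add: power2_eq_square)

lemma square_cong_imp:
  assumes "x \<in> \<pp> 0" "y \<in> \<pp> 0" "x\<^sup>2 - y\<^sup>2 \<in> \<pp> 1"
  shows "x - y \<in> \<pp> 1 \<or> x - (- y) \<in> \<pp> 1"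
proof -
  have "(x - y) * (x + y) \<in> \<pp> 1" using assms(3) by (simp add: power2_eq_square algebra_simps)
  thus ?thesis using pp_prime[of "x - y" "x + y"] assms pp_add pp_diff by auto
qed

lemma square_pp_1: "x \<in> \<pp> 0 \<Longrightarrow> x\<^sup>2 \<in> \<pp> 1 \<Longrightarrow> x \<in> \<pp> 1"
  using pp_prime[of x x] by (simp add: power2_eq_square)

text \<open>Over the residue field, u^2 = v^2 forces u = v or u = -v, and u^2 = 0 forces u = 0. Only
  upper bounds are stated; where exact counts are wanted they come out of a global count.\<close>

lemma
  assumes T: "transversal 1 (\<pp> 0) T" and y: "y \<in> \<pp> 0"
  shows card_square_roots_le: "card {u\<in>T. u\<^sup>2 - y \<in> \<pp> 1} \<le> 2"
    and card_square_roots_le_1: "y \<in> \<pp> 1 \<Longrightarrow> card {u\<in>T. u\<^sup>2 - y \<in> \<pp> 1} \<le> 1"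
proof -
  note T0 = transversal_subset[OF T]
  let ?S = "{u\<in>T. u\<^sup>2 - y \<in> \<pp> 1}"
  show "card ?S \<le> 2"
  proof (cases "?S = {}")
    case False
    then obtain v where v: "v \<in> T" "v\<^sup>2 - y \<in> \<pp> 1" by blast
    obtain w where w: "w \<in> T" "- v - w \<in> \<pp> 1"
      using transversal_obtain[OF T, of "- v"] T0[OF v(1)] by auto
    have "?S \<subseteq> {v, w}"
    proof
      fix u assume u: "u \<in> ?S"
      hence "u\<^sup>2 - v\<^sup>2 \<in> \<pp> 1" using v(2) pp_diff_commute pp_trans by blast
      hence "u - v \<in> \<pp> 1 \<or> u - (- v) \<in> \<pp> 1" using square_cong_imp T0 u v(1) by blast
      hence "u - v \<in> \<pp> 1 \<or> u - w \<in> \<pp> 1" using pp_trans w(2) by blast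
      thus "u \<in> {v, w}" using transversal_unique[OF T] u v w by blast
    qed
    hence "card ?S \<le> card {v, w}" by (intro card_mono) auto
    also have "\<dots> \<le> 2" by (simp add: card_insert_if)
    finally show ?thesis .
  next
    case True
    thus ?thesis by (simp only: card.empty)
  qed
  assume y1: "y \<in> \<pp> 1"
  have "is_singleton ?S \<or> ?S = {}"
  proof -
    have "u = v" if "u \<in> ?S" "v \<in> ?S" for u v
    proof -
      have "u\<^sup>2 \<in> \<pp> 1" "v\<^sup>2 \<in> \<pp> 1" using that pp_add[OF _ y1] by force+
      hence "u - v \<in> \<pp> 1" using square_pp_1 T0 that pp_diff by blast
      thus ?thesis using transversal_unique[OF T] that by blast
    qed
    thus ?thesis unfolding is_singleton_def by blast
  qed
  thus "card ?S \<le> 1"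
  proof
    assume "is_singleton ?S"
    thus ?thesis by (simp only: is_singleton_altdef order_refl)
  next
    assume "?S = {}"
    thus ?thesis by (simp only: card.empty zero_le_one)
  qed
qed

text \<open>Every residue class is hit exactly twice by \<open>u \<mapsto> u\<^sup>2\<close> and \<open>u \<mapsto> e u\<^sup>2\<close> together: at most twice
  by the quadratic equations, hence exactly twice by counting.\<close>

lemma residue_square_sum:
  fixes F :: "'k \<Rightarrow> complex"
  assumes T: "transversal 1 (\<pp> 0) T" and e: "nonsquare_unit_lift ord e" and F: "periodic_on 1 (\<pp> 0) F"
  shows "(\<Sum>u\<in>T. F (u\<^sup>2)) + (\<Sum>u\<in>T. F (e * u\<^sup>2)) = 2 * (\<Sum>y\<in>T. F y)"
proof -
  note T0 = transversal_subset[OF T] and fin [simp] = transversal_finite[OF T]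
  note e0 = nonsquare_unit_liftD[OF e]
  have e_int: "e \<in> \<pp> 0" "inverse e \<in> \<pp> 0" using e0 by (simp_all add: \<pp>_def)
  define n1 where "n1 y = card {u\<in>T. u\<^sup>2 - y \<in> \<pp> 1}" for y
  define n2 where "n2 y = card {u\<in>T. e * u\<^sup>2 - y \<in> \<pp> 1}" for y
  \<comment> \<open>Groups the sum by the residue class of g u. It is used for the function
    \<open>F\<close> and, with \<open>G\<close> constantly 1, for the total number of roots.\<close>
  have count: "(\<Sum>u\<in>T. G (g u)) = (\<Sum>y\<in>T. of_nat (card {u\<in>T. g u - y \<in> \<pp> 1}) * G y)"
    if G: "periodic_on 1 (\<pp> 0) G" and g: "\<And>u. u \<in> T \<Longrightarrow> g u \<in> \<pp> 0" for G g
  proof -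
    have "(\<Sum>u\<in>T. G (g u)) = (\<Sum>u\<in>T. \<Sum>y\<in>T. if g u - y \<in> \<pp> 1 then G y else 0)"
    proof (rule sum.cong)
      fix u assume u: "u \<in> T"
      obtain t where t: "t \<in> T" "g u - t \<in> \<pp> 1" using transversal_obtain[OF T g[OF u]] .
      have "(\<Sum>y\<in>T. if g u - y \<in> \<pp> 1 then G y else 0) = (\<Sum>y\<in>T. if y = t then G y else 0)"
      proof (rule sum.cong)
        fix y assume "y \<in> T"
        hence "g u - y \<in> \<pp> 1 \<longleftrightarrow> y = t"
          using transversal_unique[OF T, of y t] t pp_trans pp_diff_commute by blast
        thus "(if g u - y \<in> \<pp> 1 then G y else 0) = (if y = t then G y else 0)" by simp
      qed simp
      also have "\<dots> = G t" using t by simp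
      also have "\<dots> = G (g u)"
        using G g[OF u] T0[OF t(1)] t(2) unfolding periodic_on_def by metis
      finally show "G (g u) = (\<Sum>y\<in>T. if g u - y \<in> \<pp> 1 then G y else 0)" ..
    qed simp
    also have "\<dots> = (\<Sum>y\<in>T. \<Sum>u\<in>T. if g u - y \<in> \<pp> 1 then G y else 0)" by (rule sum.swap)
    also have "\<dots> = (\<Sum>y\<in>T. of_nat (card {u\<in>T. g u - y \<in> \<pp> 1}) * G y)"
      by (simp add: sum.If_cases Int_def)
    finally show ?thesis .
  qed
  have le2: "n1 y + n2 y \<le> 2" if y: "y \<in> T" for y
  proof -
    have n2: "n2 y = card {u\<in>T. u\<^sup>2 - inverse e * y \<in> \<pp> 1}"
    proof -
      have "e * u\<^sup>2 - y = e * (u\<^sup>2 - inverse e * y)" for u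
        using e0(1) by (simp add: right_diff_distrib mult.assoc[symmetric])
      thus ?thesis unfolding n2_def using pp_mult_left_iff[OF e0(1)] e0(2) by simp
    qed
    have y0: "y \<in> \<pp> 0" "inverse e * y \<in> \<pp> 0"
      using T0[OF y] e_int pp_mult[of "inverse e" 0 y 0] by auto
    show ?thesis
    proof (cases "y \<in> \<pp> 1")
      case True
      hence "inverse e * y \<in> \<pp> 1" using e_int pp_mult[of "inverse e" 0 y 1] by simp
      hence "n1 y \<le> 1" "n2 y \<le> 1"
        using card_square_roots_le_1[OF T] y0 True unfolding n1_def n2 by blast+
      thus ?thesis by simp
    next
      case False
      \<comment> \<open>A class away from zero that is both u^2 and e w^2 would make e congruent to
        (u/w)^2.\<close>
      have "n1 y = 0 \<or> n2 y = 0"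
      proof (rule ccontr)
        assume "\<not> ?thesis"
        hence "{u\<in>T. u\<^sup>2 - y \<in> \<pp> 1} \<noteq> {}" "{u\<in>T. e * u\<^sup>2 - y \<in> \<pp> 1} \<noteq> {}"
          unfolding n1_def n2_def by (auto simp del: Collect_empty_eq)
        then obtain u w where u: "u \<in> T" "u\<^sup>2 - y \<in> \<pp> 1" and w: "w \<in> T" "e * w\<^sup>2 - y \<in> \<pp> 1"
          by blast
        have uw: "u\<^sup>2 - e * w\<^sup>2 \<in> \<pp> 1" using u w pp_trans pp_diff_commute by blast
        have "w \<notin> \<pp> 1"
        proof
          assume "w \<in> \<pp> 1"
          hence "e * w\<^sup>2 \<in> \<pp> 1"
            using pp_mult[OF e_int(1), of "w\<^sup>2" 1] pp_mult_mono[of w 1 w 1 1]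
            by (simp add: power2_eq_square)
          thus False using pp_diff[of "e * w\<^sup>2" 1 "e * w\<^sup>2 - y"] w(2) False by simp
        qed
        hence w0: "w \<noteq> 0" "ord w = 0" using T0[OF w(1)] by (auto simp: \<pp>_def)
        have "w\<^sup>2 * ((u / w)\<^sup>2 - e) \<in> \<pp> 1"
          using uw w0 by (simp add: power_divide right_diff_distrib mult.commute)
        hence "(u / w)\<^sup>2 - e \<in> \<pp> 1"
          using w0 pp_mult_left_iff[of "w\<^sup>2"] by (simp add: ord_power2)
        moreover have "u / w \<in> \<pp> 0"
          using T0[OF u(1)] w0 by (cases "u = 0") (auto simp: \<pp>_def ord_divide)
        ultimately show False using e0(3) by blast
      qed
      moreover have "n1 y \<le> 2" "n2 y \<le> 2"
        using card_square_roots_le[OF T] y0 unfolding n1_def n2 by blast+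
      ultimately show ?thesis by auto
    qed
  qed
  have sq: "\<And>u. u \<in> T \<Longrightarrow> u\<^sup>2 \<in> \<pp> 0" "\<And>u. u \<in> T \<Longrightarrow> e * u\<^sup>2 \<in> \<pp> 0"
    using pp_square T0 pp_mult[OF e_int(1), of _ 0] by auto
  have "periodic_on 1 (\<pp> 0) (\<lambda>_. 1)" by (simp add: periodic_on_def)
  from count[OF this sq(1)] count[OF this sq(2)]
  have "complex_of_nat (\<Sum>y\<in>T. n1 y + n2 y) = of_nat (\<Sum>y\<in>T. 2)"
    by (simp add: n1_def n2_def sum.distrib)
  hence "(\<Sum>y\<in>T. n1 y + n2 y) = (\<Sum>y\<in>T. 2)" by (simp only: of_nat_eq_iff)
  \<comment> \<open>The bound \<open>le2\<close> makes the truncated subtraction exact; a sum of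
    non-negative defects that vanishes has only zero terms.\<close>
  moreover have "(\<Sum>y\<in>T. 2 - (n1 y + n2 y)) = (\<Sum>y\<in>T. 2) - (\<Sum>y\<in>T. n1 y + n2 y)"
    using le2 by (rule sum_subtractf_nat)
  ultimately have "(\<Sum>y\<in>T. 2 - (n1 y + n2 y)) = 0" by simp
  hence "2 - (n1 y + n2 y) = 0" if "y \<in> T" for y
    using that by (simp add: sum_eq_0_iff del: diff_is_0_eq)
  hence n: "n1 y + n2 y = 2" if "y \<in> T" for y using le2[OF that] that by fastforce
  have "(\<Sum>u\<in>T. F (u\<^sup>2)) + (\<Sum>u\<in>T. F (e * u\<^sup>2)) = (\<Sum>y\<in>T. of_nat (n1 y + n2 y) * F y)"
    using count[OF F sq(1)] count[OF F sq(2)] by (simp add: n1_def n2_def sum.distrib distrib_right)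
  also have "\<dots> = 2 * (\<Sum>y\<in>T. F y)" by (simp add: n sum_distrib_left)
  finally show ?thesis .
qed

text \<open>Modulo the maximal ideal, more than half of all classes are squares, so the squares meet
  \<open>u + \<theta> \<cdot> squares\<close>; the solution is then lifted using that principal units are squares.\<close>

lemma unit_in_norm_group:
  assumes \<theta>: "\<theta> \<in> shell ord 0" and u: "u \<in> shell ord 0"
  shows "u \<in> norm_group \<theta>"
proof -
  obtain T where T: "transversal 1 (\<pp> 0) T" using ex_transversal_step[of 0] by auto
  note T0 = transversal_subset[OF T] and fin [simp] = transversal_finite[OF T]
  have u0: "u \<noteq> 0" "ord u = 0" and \<theta>0: "\<theta> \<noteq> 0" "ord \<theta> = 0" using assms by (auto simp: shell_def)
  have int: "u \<in> \<pp> 0" "\<theta> \<in> \<pp> 0" using u0 \<theta>0 by (simp_all add: \<pp>_def)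
  define S where "S = {y\<in>T. \<exists>t\<in>T. t\<^sup>2 - y \<in> \<pp> 1}"
  define \<rho> where "\<rho> x = (SOME t. t \<in> T \<and> x - t \<in> \<pp> 1)" for x
  have \<rho>: "\<rho> x \<in> T" "x - \<rho> x \<in> \<pp> 1" if "x \<in> \<pp> 0" for x
    using someI_ex[of "\<lambda>t. t \<in> T \<and> x - t \<in> \<pp> 1"] transversal_obtain[OF T that]
    unfolding \<rho>_def by metis+
  obtain z where z: "z \<in> T" "0 - z \<in> \<pp> 1" using transversal_obtain[OF T pp_0] .
  have z1: "z \<in> \<pp> 1" using z(2) by simp
  have zS: "z \<in> S"
    unfolding S_def
    using z(1) pp_diff[of "z * z" 1 z] pp_mult_mono[OF z1 z1, of 1] z1
    by (intro CollectI conjI bexI[of _ z]) (simp_all add: power2_eq_square)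
  have S: "finite S" "S \<subseteq> T" by (auto simp: S_def)
  \<comment> \<open>The class of zero has a single root and every other class at most two, so card T
    is at most 2 card S - 1. The strict inequality is what the pigeonhole argument below
    needs.\<close>
  have card_T: "card T < 2 * card S"
  proof -
    have "T \<subseteq> (\<Union>y\<in>S. {t\<in>T. t\<^sup>2 - y \<in> \<pp> 1})"
    proof
      fix t assume t: "t \<in> T"
      obtain y where "y \<in> T" "t\<^sup>2 - y \<in> \<pp> 1"
        using transversal_obtain[OF T pp_square[OF T0[OF t]]] .
      thus "t \<in> (\<Union>y\<in>S. {t\<in>T. t\<^sup>2 - y \<in> \<pp> 1})" using t by (auto simp: S_def)
    qed
    hence "card T \<le> card (\<Union>y\<in>S. {t\<in>T. t\<^sup>2 - y \<in> \<pp> 1})" using S by (intro card_mono) auto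
    also have "\<dots> \<le> (\<Sum>y\<in>S. card {t\<in>T. t\<^sup>2 - y \<in> \<pp> 1})" using S(1) by (rule card_UN_le)
    also have "\<dots> = card {t\<in>T. t\<^sup>2 - z \<in> \<pp> 1} + (\<Sum>y\<in>S - {z}. card {t\<in>T. t\<^sup>2 - y \<in> \<pp> 1})"
      using S(1) zS by (rule sum.remove)
    also have "\<dots> \<le> 1 + (\<Sum>y\<in>S - {z}. 2)"
      using card_square_roots_le_1[OF T _ z1] card_square_roots_le[OF T] T0 z S
      by (intro add_mono sum_mono) auto
    also have "\<dots> < 2 * card S" using S(1) zS card_gt_0_iff[of S] by (auto simp: card_Diff_singleton)
    finally show ?thesis .
  qed
  let ?g = "\<lambda>y. \<rho> (u + \<theta> * y)"
  have int': "u + \<theta> * y \<in> \<pp> 0" if "y \<in> T" for y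
    using pp_add int pp_mult[OF int(2) T0[OF that]] by simp
  have "inj_on ?g S"
  proof (rule inj_onI)
    fix x y assume xy: "x \<in> S" "y \<in> S" "?g x = ?g y"
    have "x \<in> T" "y \<in> T" using subsetD[OF S(2)] xy(1,2) by blast+
    from \<rho>(2)[OF int'[OF this(1)]] \<rho>(2)[OF int'[OF this(2)]]
    have "(u + \<theta> * x) - (u + \<theta> * y) \<in> \<pp> 1" unfolding xy(3) by (rule pp_trans')
    hence "\<theta> * (x - y) \<in> \<pp> 1" by (simp add: right_diff_distrib)
    hence "x - y \<in> \<pp> 1" using pp_mult_left_iff[OF \<theta>0(1)] \<theta>0(2) by simp
    thus "x = y" using transversal_unique[OF T \<open>x \<in> T\<close> \<open>y \<in> T\<close>] by blast
  qed
  hence card_g: "card (?g ` S) = card S" by (rule card_image)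
  have gS: "?g ` S \<subseteq> T" using \<rho>(1) int' S(2) by blast
  have "S \<inter> ?g ` S \<noteq> {}"
  proof
    assume "S \<inter> ?g ` S = {}"
    hence "card (S \<union> ?g ` S) = 2 * card S" using card_g S(1) by (subst card_Un_disjoint) auto
    moreover have "card (S \<union> ?g ` S) \<le> card T" using S(2) gS by (intro card_mono) auto
    ultimately show False using card_T by simp
  qed
  then obtain x y where x: "x \<in> S" and y: "y \<in> S" "x = ?g y" by blast
  obtain a where a: "a \<in> T" "a\<^sup>2 - x \<in> \<pp> 1" using x by (auto simp: S_def)
  obtain b where b: "b \<in> T" "b\<^sup>2 - y \<in> \<pp> 1" using y(1) by (auto simp: S_def)
  have yT: "y \<in> T" using y(1) S(2) by blast
  have "a\<^sup>2 - (u + \<theta> * y) \<in> \<pp> 1"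
    by (rule pp_trans'[OF a(2)]) (use \<rho>(2)[OF int'[OF yT]] y(2) in \<open>simp only:\<close>)
  moreover have "\<theta> * (b\<^sup>2 - y) \<in> \<pp> 1" using pp_mult[OF int(2) b(2)] by simp
  ultimately have "(a\<^sup>2 - (u + \<theta> * y)) - \<theta> * (b\<^sup>2 - y) \<in> \<pp> 1" by (rule pp_diff)
  hence h: "(a\<^sup>2 - b\<^sup>2 * \<theta>) - u \<in> \<pp> 1" by (simp add: algebra_simps)
  have eq: "a\<^sup>2 - b\<^sup>2 * \<theta> = u + ((a\<^sup>2 - b\<^sup>2 * \<theta>) - u)" by simp
  have "a\<^sup>2 - b\<^sup>2 * \<theta> \<noteq> 0" using ord_add_eq(1)[OF u0(1), of "(a\<^sup>2 - b\<^sup>2 * \<theta>) - u"] h u0(2) by simp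
  hence "a\<^sup>2 - b\<^sup>2 * \<theta> \<in> norm_group \<theta>" using norm_group_iff by blast
  thus ?thesis using norm_group_add_iff[OF u0(1), of "(a\<^sup>2 - b\<^sup>2 * \<theta>) - u"] h u0(2) by simp
qed

end

section \<open>Characters and Gauss integrals\<close>

text \<open>The circle has no small subgroups: if w = z^(2^k) is within 1/2 of 1, then |w + 1| is at
  least 3/2, so squaring multiplies the distance to 1 by at least 3/2. A non-zero distance would
  eventually exceed 1/2.\<close>

lemma unit_complex_eq_1:
  fixes z :: complex
  assumes "\<And>k. cmod (z ^ (2 ^ k) - 1) \<le> 1 / 2"
  shows "z = 1"
proof (rule ccontr)
  assume "z \<noteq> 1"
  hence pos: "cmod (z - 1) > 0" by simp
  have grow: "cmod (z ^ (2 ^ k) - 1) \<ge> (3 / 2) ^ k * cmod (z - 1)" for k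
  proof (induction k)
    case (Suc k)
    let ?w = "z ^ (2 ^ k)"
    have "2 \<le> cmod (?w + 1) + cmod (?w - 1)"
      using norm_triangle_ineq4[of "?w + 1" "?w - 1"] by simp
    hence "3 / 2 \<le> cmod (?w + 1)" using assms[of k] by simp
    hence "(3 / 2) ^ k * cmod (z - 1) * (3 / 2) \<le> cmod (?w - 1) * cmod (?w + 1)"
      using Suc by (intro mult_mono) auto
    also have "\<dots> = cmod ((?w - 1) * (?w + 1))" by (simp only: norm_mult)
    also have "(?w - 1) * (?w + 1) = z ^ (2 ^ Suc k) - 1"
      by (simp add: algebra_simps mult_2 power_add)
    finally show ?case by (simp add: mult_ac)
  qed simp
  obtain k where "1 / cmod (z - 1) < (3 / 2 :: real) ^ k"
    using real_arch_pow[of "3 / 2"] by auto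
  hence "1 < (3 / 2) ^ k * cmod (z - 1)" using pos by (simp add: field_simps)
  thus False using grow[of k] assms[of k] by linarith
qed

context local_field
begin

text \<open>Continuity puts the values on some \<open>\<pp> k\<close> within 1/2 of 1. This ideal is
  closed under doubling, so the values are closed under squaring and must be 1. Were triviality
  inherited by every larger ideal, it would reach a point where the character is not 1.\<close>

lemma ex_conductor:
  assumes \<Phi>: "additive_character \<Phi>" and nt: "\<exists>x. \<Phi> x \<noteq> 1"
  shows "\<exists>d. (\<forall>x\<in>\<pp> d. \<Phi> x = 1) \<and> (\<exists>x\<in>\<pp> (d - 1). \<Phi> x \<noteq> 1)"
proof -
  have add: "\<Phi> (x + y) = \<Phi> x * \<Phi> y" and norm: "cmod (\<Phi> x) = 1" for x y
    using \<Phi> by (auto simp: additive_character_def)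
  have \<Phi>0: "\<Phi> 0 = 1"
  proof -
    have "\<Phi> 0 * \<Phi> 0 = \<Phi> 0 * 1" using add[of 0 0] by simp
    moreover have "\<Phi> 0 \<noteq> 0" using norm[of 0] by auto
    ultimately show ?thesis by (metis mult_left_cancel)
  qed
  have "continuous_on UNIV \<Phi>" using \<Phi> by (simp add: additive_character_def)
  then obtain \<delta> where \<delta>: "\<delta> > 0" "\<And>x. dist x 0 < \<delta> \<Longrightarrow> dist (\<Phi> x) 1 < 1 / 2"
    unfolding continuous_on_iff using \<Phi>0 by (metis UNIV_I half_gt_zero_iff zero_less_one)
  obtain k where k: "inverse \<delta> < real q ^ k"
    using real_arch_pow[of "real q"] q_ge_2 by auto
  hence "real q powi - int k < \<delta>"
    using \<delta>(1) q_ge_2 by (simp add: power_int_minus field_simps)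
  hence small: "cmod (\<Phi> x - 1) \<le> 1 / 2" if "x \<in> \<pp> (int k)" for x
    using \<delta>(2)[of x] that by (fastforce simp: pp_eq_cball dist_norm dist_commute)
  define P where "P n \<longleftrightarrow> (\<forall>x\<in>\<pp> n. \<Phi> x = 1)" for n
  have Pk: "P (int k)"
    unfolding P_def
  proof
    fix x assume x: "x \<in> \<pp> (int k)"
    have "\<exists>y\<in>\<pp> (int k). \<Phi> y = \<Phi> x ^ (2 ^ j)" for j
    proof (induction j)
      case (Suc j)
      then obtain y where y: "y \<in> \<pp> (int k)" "\<Phi> y = \<Phi> x ^ (2 ^ j)" by blast
      have "\<Phi> (y + y) = \<Phi> x ^ (2 ^ Suc j)" by (simp only: add y(2) power_Suc2 power_mult power2_eq_square)
      thus ?case using pp_add[OF y(1) y(1)] by blast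
    next
      case 0
      show ?case using x by (intro bexI[of _ x]) simp_all
    qed
    hence "cmod (\<Phi> x ^ (2 ^ j) - 1) \<le> 1 / 2" for j using small by metis
    thus "\<Phi> x = 1" by (rule unit_complex_eq_1)
  qed
  obtain x0 where x0: "\<Phi> x0 \<noteq> 1" using nt by blast
  have "\<exists>d. P d \<and> \<not> P (d - 1)"
  proof (rule ccontr)
    assume "\<not> ?thesis"
    hence step: "P (i - 1)" if "P i" for i using that by blast
    have "P i" if "i \<le> int k" for i
      using that by (induction i rule: int_le_induct) (use Pk step in auto)
    hence "P (min (int k) (ord x0))" by simp
    moreover have "x0 \<in> \<pp> (min (int k) (ord x0))" by (simp add: \<pp>_def)
    ultimately show False using x0 unfolding P_def by blast
  qed
  thus ?thesis unfolding P_def by blast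
qed

end

locale char_field = haar_field ord \<mu>
  for ord :: "'k::{field, complete_space} \<Rightarrow> int" and \<mu> +
  fixes \<Phi> :: "'k \<Rightarrow> complex" and d :: int
  assumes char_add: "\<Phi> (x + y) = \<Phi> x * \<Phi> y"
    and norm_char [simp]: "cmod (\<Phi> x) = 1"
    and char_trivial: "x \<in> \<pp> d \<Longrightarrow> \<Phi> x = 1"
    and char_nontrivial: "\<exists>x\<in>\<pp> (d - 1). \<Phi> x \<noteq> 1"
begin

lemma char_0 [simp]: "\<Phi> 0 = 1"
  by (simp add: char_trivial)

lemma char_cong: "x - y \<in> \<pp> d \<Longrightarrow> \<Phi> x = \<Phi> y"
  using char_add[of y "x - y"] char_trivial[of "x - y"] by simp

section \<open>Orthogonality of additive characters\<close>

lemma char_scaled_nontrivial: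
  assumes "b \<notin> \<pp> (d - K)"
  obtains h where "h \<in> \<pp> K" "\<Phi> (b * h) \<noteq> 1"
proof -
  obtain x where x: "x \<in> \<pp> (d - 1)" "\<Phi> x \<noteq> 1" using char_nontrivial by blast
  have b: "b \<noteq> 0" "ord b < d - K" using assms by (auto simp: \<pp>_def)
  have "x / b \<in> \<pp> (d - 1 - ord b)" using pp_mult_left_iff[OF b(1), of "x / b" "d - 1"] x b by simp
  hence "x / b \<in> \<pp> K" by (rule pp_mono) (use b(2) in linarith)
  thus ?thesis using that[of "x / b"] x b by simp
qed

text \<open>Orthogonality on \<open>\<pp> K\<close> modulo \<open>\<pp> n\<close>: the first
  condition on b makes h \<mapsto> \<open>\<Phi> (b * h)\<close> well defined on the quotient, the
  second makes it non-trivial there.\<close>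

lemma sum_char_eq_0:
  assumes T: "transversal n (\<pp> K) T" and b: "b \<in> \<pp> (d - n)" "b \<notin> \<pp> (d - K)"
  shows "(\<Sum>h\<in>T. \<Phi> (b * h)) = 0"
proof -
  obtain k where k: "k \<in> \<pp> K" "\<Phi> (b * k) \<noteq> 1" using char_scaled_nontrivial[OF b(2)] .
  have per: "periodic_on n (\<pp> K) (\<lambda>h. \<Phi> (b * h))"
    unfolding periodic_on_def
  proof (intro ballI impI)
    fix x y assume "x - y \<in> \<pp> n"
    thus "\<Phi> (b * x) = \<Phi> (b * y)"
      using pp_mult[OF b(1), of "x - y" n] by (intro char_cong) (simp add: right_diff_distrib)
  qed
  have "(\<Sum>h\<in>T. \<Phi> (b * h)) = (\<Sum>h\<in>T. \<Phi> (b * (h + k)))"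
    by (rule transversal_sum_reindex[OF T per, symmetric]) (use k pp_add in auto)
  also have "\<dots> = \<Phi> (b * k) * (\<Sum>h\<in>T. \<Phi> (b * h))"
    by (simp add: distrib_left char_add sum_distrib_left mult.commute)
  finally show ?thesis using k(2) by (simp add: mult_cancel_right1)
qed

lemma integral_pp_const: "(LINT y:\<pp> K|\<mu>. 1) = complex_of_real (real q powi - K)"
proof -
  have "integrable \<mu> (indicator (\<pp> K) :: 'k \<Rightarrow> real)"
    by (rule integrable_real_indicator) (simp_all add: emeasure_pp)
  thus ?thesis unfolding set_lebesgue_integral_def
    by (subst integral_scaleR_left) (simp_all add: measure_pp scaleR_conv_of_real)
qed

lemma integral_char:
  "(LINT y:\<pp> K|\<mu>. \<Phi> (b * y)) = (if b \<in> \<pp> (d - K) then of_real (real q powi - K) else 0)"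
proof (cases "b \<in> \<pp> (d - K)")
  case True
  have "(LINT y:\<pp> K|\<mu>. \<Phi> (b * y)) = (LINT y:\<pp> K|\<mu>. 1)"
  proof (rule set_lebesgue_integral_cong)
    show "\<forall>y. y \<in> \<pp> K \<longrightarrow> \<Phi> (b * y) = 1" using char_trivial pp_mult[OF True, of _ K] by auto
  qed simp
  thus ?thesis using True by (simp only: integral_pp_const if_True)
next
  case False
  obtain k where k: "k \<in> \<pp> K" "\<Phi> (b * k) \<noteq> 1" using char_scaled_nontrivial[OF False] .
  have "(LINT y:\<pp> K|\<mu>. \<Phi> (b * y)) = (LINT y:\<pp> K|\<mu>. \<Phi> (b * (y + k)))"
    by (rule set_integral_translate[symmetric]) (simp add: pp_add_cancel k)
  also have "\<dots> = \<Phi> (b * k) * (LINT y:\<pp> K|\<mu>. \<Phi> (b * y))"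
    by (simp add: distrib_left char_add mult.commute)
  finally show ?thesis using k(2) False by (simp add: mult_cancel_right1)
qed

lemma integral_pp_split:
  fixes f :: "'k \<Rightarrow> complex"
  assumes "set_integrable \<mu> (\<pp> l) f"
  shows "(LINT t:\<pp> l|\<mu>. f t) = (LINT t:shell ord l|\<mu>. f t) + (LINT t:\<pp> (l + 1)|\<mu>. f t)"
proof -
  have "\<pp> (l + 1) \<subseteq> \<pp> l" using pp_mono by fastforce
  hence eq: "\<pp> l = shell ord l \<union> \<pp> (l + 1)" unfolding shell_eq_Diff by blast
  have "set_integrable \<mu> (shell ord l) f" "set_integrable \<mu> (\<pp> (l + 1)) f"
    by (rule set_integrable_subset[OF assms]; use eq in auto)+
  moreover have "shell ord l \<inter> \<pp> (l + 1) = {}" unfolding shell_eq_Diff by blast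
  ultimately show ?thesis by (subst eq) (rule set_integral_Un)
qed

section \<open>Gauss integrals and their behaviour under a non-square unit\<close>

lemma periodic_quadratic:
  assumes "a \<in> \<pp> (d - n - l)" "l \<le> n"
  shows "periodic_on n (\<pp> l) (\<lambda>t. \<Phi> (a * t\<^sup>2))"
  unfolding periodic_on_def
proof (intro ballI impI)
  fix x y assume "x \<in> \<pp> l" "y \<in> \<pp> l" "x - y \<in> \<pp> n"
  hence "(x - y) * (x + y) \<in> \<pp> (n + l)" by (intro pp_mult pp_add)
  hence "a * ((x - y) * (x + y)) \<in> \<pp> d" using pp_mult[OF assms(1)] by fastforce
  thus "\<Phi> (a * x\<^sup>2) = \<Phi> (a * y\<^sup>2)"
    by (intro char_cong) (simp add: power2_eq_square algebra_simps)
qed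

lemma integrable_quadratic: "set_integrable \<mu> (\<pp> l) (\<lambda>t. \<Phi> (a * t\<^sup>2))"
proof -
  \<comment> \<open>The least index not below l that makes the quadratic phase periodic: a(x - y)(x
    + y) has to land in \<open>\<pp> d\<close> when x + y lies in \<open>\<pp> l\<close>.\<close>
  let ?n = "max l (d - ord a - l)"
  obtain T where "transversal ?n (\<pp> l) T"
    using ex_transversal[OF saturated_pp, of l ?n l] by auto
  moreover have "a \<in> \<pp> (d - ?n - l)" by (auto simp: \<pp>_def)
  ultimately show ?thesis
    using integral_transversal(1)[OF _ saturated_pp periodic_quadratic, of ?n l T a] by simp
qed

lemma integral_quadratic_shell:
  assumes a: "a \<noteq> 0" "2 * l + ord a < d - 1"
  shows "(LINT t:shell ord l|\<mu>. \<Phi> (a * t\<^sup>2)) = 0"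
proof -
  \<comment> \<open>With this K the linear term 2ath is a character of h that is non-trivial on
    \<open>\<pp> K\<close> and trivial on \<open>\<pp> (K + 1)\<close>; 2 being a unit enters here.
    As l < K, the term a h^2 lies in \<open>\<pp> d\<close>.\<close>
  define K where "K = d - 1 - ord a - l"
  have K: "l < K" using a(2) by (simp add: K_def)
  obtain H where H: "transversal (K + 1) (\<pp> K) H" using ex_transversal_step by blast
  have zero: "(\<Sum>h\<in>H. indicator (shell ord l) (t + h) *\<^sub>R \<Phi> (a * (t + h)\<^sup>2)) = 0" for t
  proof (cases "t \<in> shell ord l")
    case True
    hence t: "t \<noteq> 0" "ord t = l" by (auto simp: shell_def)
    have ord: "ord (2 * a * t) = ord a + l" "2 * a * t \<noteq> 0" using t a two_unit by (simp_all add: ord_mult)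
    have "indicator (shell ord l) (t + h) *\<^sub>R \<Phi> (a * (t + h)\<^sup>2) = \<Phi> (a * t\<^sup>2) * \<Phi> (2 * a * t * h)"
      if "h \<in> H" for h
    proof -
      have h: "h \<in> \<pp> K" using transversal_subset[OF H that] .
      have "h * h \<in> \<pp> (2 * K)" using pp_mult[OF h h] by simp
      hence "a * (h * h) \<in> \<pp> d" using a K by (simp add: pp_mult_left_iff K_def pp_mono[of _ "2 * K"])
      hence "\<Phi> (a * (t + h)\<^sup>2) = \<Phi> (a * t\<^sup>2 + 2 * a * t * h)"
        by (intro char_cong) (simp add: power2_eq_square algebra_simps)
      thus ?thesis using True shell_add_iff[OF h K] by (simp add: char_add)
    qed
    hence "(\<Sum>h\<in>H. indicator (shell ord l) (t + h) *\<^sub>R \<Phi> (a * (t + h)\<^sup>2)) =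
        \<Phi> (a * t\<^sup>2) * (\<Sum>h\<in>H. \<Phi> (2 * a * t * h))"
      by (simp add: sum_distrib_left)
    also have "(\<Sum>h\<in>H. \<Phi> (2 * a * t * h)) = 0"
      by (rule sum_char_eq_0[OF H]) (use ord in \<open>simp_all add: pp_iff K_def\<close>)
    finally show ?thesis by simp
  next
    case False
    thus ?thesis using shell_add_iff[OF transversal_subset[OF H] K] by (intro sum.neutral) auto
  qed
  have "H \<noteq> {}" using transversal_obtain[OF H pp_0] by blast
  thus ?thesis
    unfolding set_lebesgue_integral_def
    using integral_eq_0_if_average_eq_0[OF transversal_finite[OF H] _ zero] by blast
qed

definition gauss :: "'k \<Rightarrow> complex" where
  "gauss a = (LINT t:\<pp> 0|\<mu>. \<Phi> (a * t\<^sup>2))"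

text \<open>The shells 0, ..., L - 1 all contribute zero; the bound is the vanishing condition 2l +
  ord a < d - 1 at the last one, l = L - 1.\<close>

lemma gauss_eq_integral_pp:
  assumes "a \<noteq> 0" "2 * int L + ord a < d + 1"
  shows "gauss a = (LINT t:\<pp> (int L)|\<mu>. \<Phi> (a * t\<^sup>2))"
  using assms(2)
proof (induction L)
  case (Suc L)
  have "gauss a = (LINT t:\<pp> (int L)|\<mu>. \<Phi> (a * t\<^sup>2))" using Suc by simp
  also have "\<dots> = (LINT t:\<pp> (int L + 1)|\<mu>. \<Phi> (a * t\<^sup>2))"
    using integral_pp_split[OF integrable_quadratic, of "int L" a]
      integral_quadratic_shell[OF assms(1), of "int L"] Suc.prems by simp
  finally show ?case by (simp add: add.commute)
qed (simp add: gauss_def)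

text \<open>After removal of the vanishing shells the phase is trivial on what is left, so the value
  depends on ord a alone.\<close>

lemma gauss_even:
  assumes "a \<noteq> 0" "d - ord a = 2 * int L"
  shows "gauss a = of_real (real q powi - int L)"
proof -
  have "a * t\<^sup>2 \<in> \<pp> d" if "t \<in> \<pp> (int L)" for t
    using pp_mult[OF that that] assms by (simp add: pp_mult_left_iff power2_eq_square)
  hence "(LINT t:\<pp> (int L)|\<mu>. \<Phi> (a * t\<^sup>2)) = (LINT t:\<pp> (int L)|\<mu>. 1)"
    by (intro set_lebesgue_integral_cong) (simp_all add: char_trivial)
  hence "gauss a = (LINT t:\<pp> (int L)|\<mu>. 1)"
    using assms by (simp add: gauss_eq_integral_pp[of a L])
  thus ?thesis by (simp only: integral_pp_const)
qed

text \<open>After removal of the vanishing shells a quadratic Gauss sum over the residue field is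
  left. Its values for a and for e a run over squares and over e times squares, so together they
  give twice the sum of a non-trivial additive character, which is 0.\<close>

lemma gauss_odd:
  assumes e: "nonsquare_unit_lift ord e" and a: "a \<noteq> 0" "d - ord a = 2 * int L + 1"
  shows "gauss (e * a) = - gauss a"
proof -
  note e0 = nonsquare_unit_liftD[OF e]
  obtain c where c: "c \<noteq> 0" "ord c = int L" using ex_ord .
  obtain R where R: "transversal 1 (\<pp> 0) R" using ex_transversal_step[of 0] by auto
  have T: "transversal (1 + int L) (\<pp> (int L)) ((*) c ` R)"
    using transversal_scale(1)[OF R c(1)] pp_scale[OF c(1), of 0] c by simp
  have eval: "gauss b = of_real (real q powi - (1 + int L)) * (\<Sum>u\<in>R. \<Phi> (b * c\<^sup>2 * u\<^sup>2))"
    if b: "b \<noteq> 0" "ord b = ord a" for b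
  proof -
    have per: "periodic_on (1 + int L) (\<pp> (int L)) (\<lambda>t. \<Phi> (b * t\<^sup>2))"
      using a b by (intro periodic_quadratic) (simp_all add: pp_iff)
    have "gauss b = (LINT t:\<pp> (int L)|\<mu>. \<Phi> (b * t\<^sup>2))" using a b by (intro gauss_eq_integral_pp) auto
    also have "\<dots> = of_real (real q powi - (1 + int L)) * (\<Sum>t\<in>(*) c ` R. \<Phi> (b * t\<^sup>2))"
      by (rule integral_transversal(2)[OF T saturated_pp per]) simp
    also have "(\<Sum>t\<in>(*) c ` R. \<Phi> (b * t\<^sup>2)) = (\<Sum>u\<in>R. \<Phi> (b * c\<^sup>2 * u\<^sup>2))"
      using c by (subst sum.reindex) (auto simp: inj_on_def power_mult_distrib mult_ac)
    finally show ?thesis .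
  qed
  let ?F = "\<lambda>y. \<Phi> (a * c\<^sup>2 * y)"
  have ord: "a * c\<^sup>2 \<noteq> 0" "ord (a * c\<^sup>2) = d - 1" using a c by (simp_all add: ord_mult ord_power2)
  have per: "periodic_on 1 (\<pp> 0) ?F"
    unfolding periodic_on_def
  proof (intro ballI impI)
    fix x y assume "x - y \<in> \<pp> 1"
    hence "a * c\<^sup>2 * (x - y) \<in> \<pp> d" using ord by (simp add: pp_mult_left_iff)
    thus "?F x = ?F y" by (intro char_cong) (simp add: right_diff_distrib)
  qed
  have "(\<Sum>u\<in>R. ?F (u\<^sup>2)) + (\<Sum>u\<in>R. ?F (e * u\<^sup>2)) = 2 * (\<Sum>y\<in>R. ?F y)"
    by (rule residue_square_sum[OF R e per])
  also have "(\<Sum>y\<in>R. ?F y) = 0"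
    by (rule sum_char_eq_0[OF R]) (use ord in \<open>simp_all add: pp_iff\<close>)
  finally have "(\<Sum>u\<in>R. \<Phi> (e * a * c\<^sup>2 * u\<^sup>2)) = - (\<Sum>u\<in>R. \<Phi> (a * c\<^sup>2 * u\<^sup>2))"
    by (simp add: eq_neg_iff_add_eq_0 mult_ac add.commute)
  thus ?thesis using eval[of a] eval[of "e * a"] a e0 by (simp add: ord_mult)
qed

lemma gauss_twist:
  assumes e: "nonsquare_unit_lift ord e" and a: "a \<noteq> 0" "ord a \<le> d"
  shows "gauss (e * a) = (-1) powi (d - ord a) * gauss a"
proof (cases "even (d - ord a)")
  case True
  then obtain k where k: "d - ord a = 2 * k" by blast
  have "k \<ge> 0" using k a(2) by linarith
  then obtain L where "k = int L" by (rule nonneg_int_cases)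
  thus ?thesis
    using k a gauss_even[of a L] gauss_even[of "e * a" L] nonsquare_unit_liftD[OF e] True
    by (simp add: ord_mult power_int_minus_left)
next
  case False
  then obtain k where k: "d - ord a = 2 * k + 1" by (elim oddE)
  have "k \<ge> 0" using k a(2) by linarith
  then obtain L where "k = int L" by (rule nonneg_int_cases)
  thus ?thesis using gauss_odd[OF e a(1), of L] k False by (simp add: power_int_minus_left)
qed

lemma norm_set_integral_le_measure:
  fixes f :: "'k \<Rightarrow> complex"
  assumes "\<And>t. cmod (f t) = 1"
  shows "norm (LINT t:A|\<mu>. f t) \<le> measure \<mu> (A \<inter> space \<mu>)"
proof -
  have "norm (LINT t:A|\<mu>. f t) \<le> (\<integral>t. norm (indicator A t *\<^sub>R f t) \<partial>\<mu>)"
    unfolding set_lebesgue_integral_def by (rule integral_norm_bound)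
  also have "\<dots> = (\<integral>t. indicator A t \<partial>\<mu>)" using assms by simp
  finally show ?thesis by simp
qed

text \<open>Negative shells contribute 0 under the bound on ord a. The infinite sum is
  unconditional, so convergence of the telescoping partial sums is supplemented by absolute
  summability: the shell n contributes at most q^(-n).\<close>

lemma infsum_gauss:
  assumes a: "a \<noteq> 0" "ord a \<le> d - 1"
  shows "(\<Sum>\<^sub>\<infinity>l\<in>UNIV. LINT t:shell ord l|\<mu>. \<Phi> (a * t\<^sup>2)) = gauss a"
proof -
  let ?f = "\<lambda>l. LINT t:shell ord l|\<mu>. \<Phi> (a * t\<^sup>2)"
  have q: "real q > 1" using q_ge_2 by simp
  have pow: "real q powi - int n = (1 / real q) ^ n" for n
    by (simp add: power_int_minus power_one_over inverse_eq_divide)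
  have partial: "(\<Sum>n<N. ?f (int n)) = gauss a - (LINT t:\<pp> (int N)|\<mu>. \<Phi> (a * t\<^sup>2))" for N
  proof (induction N)
    case (Suc N)
    thus ?case using integral_pp_split[OF integrable_quadratic, of "int N" a] by (simp add: add.commute)
  qed (simp add: gauss_def)
  have "(\<lambda>N. LINT t:\<pp> (int N)|\<mu>. \<Phi> (a * t\<^sup>2)) \<longlonglongrightarrow> 0"
  proof (rule Lim_null_comparison)
    have "norm (LINT t:\<pp> (int N)|\<mu>. \<Phi> (a * t\<^sup>2)) \<le> (1 / real q) ^ N" for N
      using norm_set_integral_le_measure[of "\<lambda>t. \<Phi> (a * t\<^sup>2)" "\<pp> (int N)"]
      by (simp add: measure_pp pow)
    thus "\<forall>\<^sub>F N in sequentially. norm (LINT t:\<pp> (int N)|\<mu>. \<Phi> (a * t\<^sup>2)) \<le> (1 / real q) ^ N"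
      by (intro always_eventually allI)
    show "(\<lambda>N. (1 / real q) ^ N) \<longlonglongrightarrow> 0" using q by (intro LIMSEQ_realpow_zero) auto
  qed
  hence "(\<lambda>N. \<Sum>n<N. ?f (int n)) \<longlonglongrightarrow> gauss a - 0"
    unfolding partial by (intro tendsto_diff tendsto_const)
  hence sums: "(\<lambda>n. ?f (int n)) sums gauss a" by (simp add: sums_def)
  have "summable (\<lambda>n. norm (?f (int n)))"
  proof (rule summable_comparison_test[OF _ summable_geometric[of "1 / real q"]])
    have "norm (?f (int n)) \<le> (1 / real q) ^ n" for n
    proof -
      have "norm (?f (int n)) \<le> measure \<mu> (shell ord (int n))"
        using norm_set_integral_le_measure[of "\<lambda>t. \<Phi> (a * t\<^sup>2)" "shell ord (int n)"] by simp
      also have "\<dots> \<le> measure \<mu> (\<pp> (int n))"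
        by (rule measure_mono_fmeasurable) (auto simp: shell_eq_Diff fmeasurable_def emeasure_pp)
      finally show ?thesis by (simp add: measure_pp pow)
    qed
    thus "\<exists>N. \<forall>n\<ge>N. norm (norm (?f (int n))) \<le> (1 / real q) ^ n" by simp
  qed (use q in simp)
  hence "((\<lambda>n. ?f (int n)) has_sum gauss a) UNIV" using sums by (rule norm_summable_imp_has_sum)
  hence "(?f has_sum gauss a) (range int)" by (subst has_sum_reindex) (auto simp: o_def)
  moreover have "?f l = 0" if "l \<notin> range int" for l
  proof -
    have "l < 0" using that by (metis nonneg_int_cases not_less rangeI)
    thus ?thesis using a by (intro integral_quadratic_shell) auto
  qed
  ultimately have "(?f has_sum gauss a) UNIV"
    using has_sum_cong_neutral[of UNIV "range int" ?f ?f] by simp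
  thus ?thesis by (rule infsumI)
qed

end

section \<open>The mock Fourier transform\<close>

context haar_field
begin

text \<open>The density 1/|x| is the constant q^n on the shell. Nothing is known about
  \<open>f\<close>; if it is not measurable on the shell, both integrals are the default value
  0.\<close>

lemma integral_mult_haar_shell:
  fixes f :: "'k \<Rightarrow> complex"
  shows "(LINT x:shell ord n|mult_haar ord \<mu>. f x) = of_real (real q powi n) * (LINT x:shell ord n|\<mu>. f x)"
proof -
  let ?g = "\<lambda>x. indicator (shell ord n) x *\<^sub>R f x"
  have nabs_meas: "(\<lambda>x. inverse (nabs ord x)) \<in> borel_measurable \<mu>"
  proof -
    have "(\<lambda>x::'k. dist x 0) \<in> borel_measurable borel"
      by (intro borel_measurable_continuous_onI continuous_intros)
    hence "nabs ord \<in> borel_measurable borel" by (simp add: dist_nabs)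
    hence "nabs ord \<in> borel_measurable \<mu>" by (simp add: measurable_cong_sets[OF sets_mu refl])
    thus ?thesis by measurable
  qed
  show ?thesis
  proof (cases "?g \<in> borel_measurable \<mu>")
    case True
    have "integral\<^sup>L (mult_haar ord \<mu>) ?g = (\<integral>x. inverse (nabs ord x) *\<^sub>R ?g x \<partial>\<mu>)"
      unfolding mult_haar_def
      by (rule integral_density[OF True nabs_meas]) (simp add: nabs_def)
    also have "\<dots> = (\<integral>x. of_real (real q powi n) * ?g x \<partial>\<mu>)"
      by (intro Bochner_Integration.integral_cong)
        (auto simp: indicator_def nabs_def shell_def power_int_minus scaleR_conv_of_real)
    also have "\<dots> = of_real (real q powi n) * integral\<^sup>L \<mu> ?g"
      by (rule integral_mult_right_zero)
    finally show ?thesis by (simp only: set_lebesgue_integral_def)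
  next
    case False
    hence "\<not> integrable \<mu> ?g" "\<not> integrable (mult_haar ord \<mu>) ?g"
      by (auto dest!: borel_measurable_integrable simp: mult_haar_def)
    thus ?thesis by (simp add: set_lebesgue_integral_def not_integrable_integral_eq)
  qed
qed

end

context char_field
begin

section \<open>Invariance of the inner sum and vanishing of the outer shells\<close>

lemma inverse_add_diff:
  fixes x h :: 'k
  assumes "x \<noteq> 0" "x + h \<noteq> 0"
  shows "inverse (x + h) - inverse x = - (h * inverse x * inverse (x + h))"
  using assms by (simp add: field_simps)

lemma inverse_add_in_pp:
  assumes "x \<in> shell ord n" "h \<in> \<pp> K" "n < K"
  shows "inverse x \<in> \<pp> (- n)" "inverse (x + h) \<in> \<pp> (- n)" "x \<noteq> 0" "x + h \<noteq> 0"
    "inverse (x + h) - inverse x \<in> \<pp> (K - 2 * n)"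
proof -
  have sh: "x + h \<in> shell ord n" using shell_add_iff assms by blast
  show nz: "x \<noteq> 0" "x + h \<noteq> 0" using assms(1) sh by (auto simp: shell_def)
  show i: "inverse x \<in> \<pp> (- n)" "inverse (x + h) \<in> \<pp> (- n)"
    using assms(1) sh by (auto simp: shell_def pp_iff)
  show "inverse (x + h) - inverse x \<in> \<pp> (K - 2 * n)"
    unfolding inverse_add_diff[OF nz] using pp_mult[OF pp_mult[OF assms(2) i(1)] i(2)] by simp
qed

text \<open>Shows without evaluation that the inner sum is locally constant in x. Either both shell
  integrals vanish, or 2l + ord c - n is at least d - 1; then the phase changes by an element of
  valuation at least (d - 1) + (K - n), and K > n supplies the missing 1.\<close>

lemma quadratic_shell_perturb:
  assumes c: "c \<noteq> 0" and x: "x \<in> shell ord n" and h: "h \<in> \<pp> K" "n < K"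
  shows "(LINT t:shell ord l|\<mu>. \<Phi> (- c * inverse (x + h) * t\<^sup>2)) =
    (LINT t:shell ord l|\<mu>. \<Phi> (- c * inverse x * t\<^sup>2))"
proof -
  note inv = inverse_add_in_pp[OF x h]
  have sh: "x + h \<in> shell ord n" using shell_add_iff x h by blast
  have ord: "ord (- c * inverse x) = ord c - n" "ord (- c * inverse (x + h)) = ord c - n"
    using x sh c by (auto simp: shell_def ord_mult)
  show ?thesis
  proof (cases "2 * l + (ord c - n) < d - 1")
    case True
    thus ?thesis
      using integral_quadratic_shell[of "- c * inverse x" l]
        integral_quadratic_shell[of "- c * inverse (x + h)" l] c inv(3,4) ord by simp
  next
    case False
    show ?thesis
    proof (rule set_lebesgue_integral_cong)
      show "\<forall>t. t \<in> shell ord l \<longrightarrow> \<Phi> (- c * inverse (x + h) * t\<^sup>2) = \<Phi> (- c * inverse x * t\<^sup>2)"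
      proof (intro allI impI)
        fix t assume "t \<in> shell ord l"
        hence "t * t \<in> \<pp> (l + l)" by (intro pp_mult) (auto simp: shell_iff)
        moreover have "- c \<in> \<pp> (ord c)" using c by (simp add: pp_iff)
        ultimately have "- c * (inverse (x + h) - inverse x) * (t * t) \<in> \<pp> d"
          using False h(2) by (intro pp_mult_mono[OF pp_mult[OF _ inv(5)]]) auto
        thus "\<Phi> (- c * inverse (x + h) * t\<^sup>2) = \<Phi> (- c * inverse x * t\<^sup>2)"
          by (intro char_cong) (simp add: power2_eq_square algebra_simps)
      qed
    qed simp
  qed
qed

definition inner_sum :: "'k \<Rightarrow> 'k \<Rightarrow> complex" where
  "inner_sum c x = (\<Sum>\<^sub>\<infinity>l\<in>UNIV. LINT t:shell ord l|\<mu>. \<Phi> (- c * inverse x * t\<^sup>2))"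

lemma infsum_shell_factor:
  "(\<Sum>\<^sub>\<infinity>l\<in>UNIV. LINT t:shell ord l|\<mu>. \<Phi> (c * (x * \<theta> + inverse x * \<theta> - inverse x * t\<^sup>2))) =
    \<Phi> (c * \<theta> * (x + inverse x)) * inner_sum c x"
proof -
  have "\<Phi> (c * (x * \<theta> + inverse x * \<theta> - inverse x * t\<^sup>2)) =
      \<Phi> (c * \<theta> * (x + inverse x)) * \<Phi> (- c * inverse x * t\<^sup>2)" for t
    by (simp add: char_add[symmetric] algebra_simps)
  thus ?thesis by (simp add: inner_sum_def infsum_cmult_right')
qed

text \<open>The phase c\<theta>(x + 1/x) has derivative c\<theta>(1 - 1/x^2). For n non-zero one of
  its two terms dominates, so a small translation multiplies the integrand by a non-trivial
  character; at n = 0 the terms can cancel, and that shell survives.\<close>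

lemma outer_shell_eq_0:
  assumes c: "c \<noteq> 0" "ord c \<le> d - 1" and \<theta>: "\<theta> \<in> shell ord 0" and n: "n \<noteq> 0"
  shows "(LINT x:shell ord n|mult_haar ord \<mu>.
    indicator (norm_group \<theta>) x * (\<Phi> (c * \<theta> * (x + inverse x)) * inner_sum c x)) = 0"
proof -
  let ?f = "\<lambda>x. indicator (norm_group \<theta>) x * (\<Phi> (c * \<theta> * (x + inverse x)) * inner_sum c x)"
  \<comment> \<open>Chosen so that ord (b x) + K = d - 1: the linear term is non-trivial on
    \<open>\<pp> K\<close> but trivial on \<open>\<pp> (K + 1)\<close>. The summand 2n compensates
    for the factor 1/x^2 in \<open>b\<close>.\<close>
  define K where "K = d - ord c - 1 + (if n > 0 then 2 * n else 0)"
  define b where "b x = (if n > 0 then - (c * \<theta> * (inverse x)\<^sup>2) else c * \<theta>)" for x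
  have nK: "n < K" using c n by (auto simp: K_def)
  have \<theta>0: "\<theta> \<noteq> 0" "ord \<theta> = 0" using \<theta> by (auto simp: shell_def)
  have c\<theta>: "c * \<theta> \<in> \<pp> (ord c)" using c \<theta>0 by (simp add: pp_iff ord_mult)
  obtain H where H: "transversal (K + 1) (\<pp> K) H" using ex_transversal_step by blast
  have shift: "?f (x + h) = ?f x * \<Phi> (b x * h)" if x: "x \<in> shell ord n" and h: "h \<in> \<pp> K" for x h
  proof -
    note inv = inverse_add_in_pp[OF x h nK]
    have h1: "h \<in> \<pp> (ord x + 1)" using x h nK by (intro pp_mono[OF h]) (auto simp: shell_def)
    have inner: "inner_sum c (x + h) = inner_sum c x"
      unfolding inner_sum_def by (intro infsum_cong quadratic_shell_perturb[OF c(1) x h nK])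
    have ind: "indicator (norm_group \<theta>) (x + h) = (indicator (norm_group \<theta>) x :: complex)"
      using norm_group_add_iff[OF inv(3) h1] by (simp add: indicator_def)
    have "c * \<theta> * ((x + h) + inverse (x + h)) - (c * \<theta> * (x + inverse x) + b x * h) \<in> \<pp> d"
    proof (cases "n > 0")
      case True
      \<comment> \<open>For n > 0 two errors must vanish modulo \<open>\<pp> d\<close>: the change
        of the dominated term x, and the second-order part of 1/(x + h).\<close>
      have "c * \<theta> * h \<in> \<pp> d" using True by (intro pp_mult_mono[OF c\<theta> h]) (simp add: K_def)
      moreover have "c * \<theta> * ((h * inverse x) * (inverse (x + h) - inverse x)) \<in> \<pp> d"
        using True c n by (intro pp_mult_mono[OF c\<theta> pp_mult[OF pp_mult[OF h inv(1)] inv(5)]]) (simp add: K_def)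
      ultimately have "c * \<theta> * h - c * \<theta> * ((h * inverse x) * (inverse (x + h) - inverse x)) \<in> \<pp> d"
        by (rule pp_diff)
      also have "c * \<theta> * h - c * \<theta> * ((h * inverse x) * (inverse (x + h) - inverse x)) =
          c * \<theta> * (h + (- (h * inverse x * inverse (x + h)))) - b x * h"
        using True by (simp add: b_def power2_eq_square algebra_simps)
      also have "\<dots> = c * \<theta> * ((x + h) + inverse (x + h)) - (c * \<theta> * (x + inverse x) + b x * h)"
        unfolding inverse_add_diff[OF inv(3,4), symmetric] by (simp add: algebra_simps)
      finally show ?thesis .
    next
      case False
      have "c * \<theta> * (inverse (x + h) - inverse x) \<in> \<pp> d"
        using False n by (intro pp_mult_mono[OF c\<theta> inv(5)]) (simp add: K_def)
      thus ?thesis using False by (simp add: b_def algebra_simps)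
    qed
    hence "\<Phi> (c * \<theta> * ((x + h) + inverse (x + h))) = \<Phi> (c * \<theta> * (x + inverse x)) * \<Phi> (b x * h)"
      unfolding char_add[symmetric] by (rule char_cong)
    thus ?thesis unfolding inner ind by simp
  qed
  have zero: "(\<Sum>h\<in>H. indicator (shell ord n) (x + h) *\<^sub>R ?f (x + h)) = 0" for x
  proof (cases "x \<in> shell ord n")
    case True
    hence x: "x \<noteq> 0" "ord x = n" by (auto simp: shell_def)
    have "(\<Sum>h\<in>H. indicator (shell ord n) (x + h) *\<^sub>R ?f (x + h)) = (\<Sum>h\<in>H. ?f x * \<Phi> (b x * h))"
    proof (rule sum.cong)
      fix h assume "h \<in> H"
      hence h: "h \<in> \<pp> K" by (rule transversal_subset[OF H])
      show "indicator (shell ord n) (x + h) *\<^sub>R ?f (x + h) = ?f x * \<Phi> (b x * h)"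
        unfolding shift[OF True h] using True shell_add_iff[OF h nK] by simp
    qed simp
    also have "\<dots> = ?f x * (\<Sum>h\<in>H. \<Phi> (b x * h))" by (rule sum_distrib_left[symmetric])
    also have "(\<Sum>h\<in>H. \<Phi> (b x * h)) = 0"
    proof (rule sum_char_eq_0[OF H])
      have "b x \<noteq> 0" "ord (b x) = d - 1 - K"
        using c \<theta>0 x by (auto simp: b_def ord_mult ord_power2 K_def)
      thus "b x \<in> \<pp> (d - (K + 1))" "b x \<notin> \<pp> (d - K)" by (simp_all add: pp_iff)
    qed
    finally show ?thesis by simp
  next
    case False
    thus ?thesis using shell_add_iff[OF transversal_subset[OF H] nK] by (intro sum.neutral) auto
  qed
  have "H \<noteq> {}" using transversal_obtain[OF H pp_0] by blast
  hence "(LINT x:shell ord n|\<mu>. ?f x) = 0"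
    unfolding set_lebesgue_integral_def
    using integral_eq_0_if_average_eq_0[OF transversal_finite[OF H] _ zero] by blast
  thus ?thesis by (simp only: integral_mult_haar_shell mult_zero_right)
qed

text \<open>A Ramanujan sum: inversion permutes the unit classes, so 1/y may be replaced by y, and
  the sum over units is the integral over the integers minus that over the maximal ideal, scaled by
  q^m.\<close>

lemma sum_units_char:
  assumes U: "transversal m (shell ord 0) U" and m: "m \<ge> 1" and b: "b \<in> \<pp> (d - m)"
  shows "(\<Sum>y\<in>U. \<Phi> (b * inverse y)) =
    of_real (real q powi m) * (of_bool (b \<in> \<pp> d) - of_bool (b \<in> \<pp> (d - 1)) / of_nat q)"
proof -
  have q: "real q > 0" using q_ge_2 by simp
  have per: "periodic_on m A (\<lambda>y. \<Phi> (b * y))" for A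
    unfolding periodic_on_def
  proof (intro ballI impI)
    fix x y assume "x - y \<in> \<pp> m"
    thus "\<Phi> (b * x) = \<Phi> (b * y)"
      using pp_mult[OF b, of "x - y" m] by (intro char_cong) (simp add: right_diff_distrib)
  qed
  have "(\<Sum>y\<in>U. \<Phi> (b * inverse y)) = (\<Sum>y\<in>U. \<Phi> (b * y))"
  proof (rule transversal_sum_reindex[OF U per])
    fix x y assume "x \<in> shell ord 0" "y \<in> shell ord 0" and xy: "inverse x - inverse y \<in> \<pp> m"
    hence u: "x \<noteq> 0" "y \<noteq> 0" "x \<in> \<pp> 0" "y \<in> \<pp> 0" by (auto simp: shell_def \<pp>_def)
    have "x * y * (inverse x - inverse y) = y - x" using u by (simp add: field_simps)
    thus "x - y \<in> \<pp> m"
      using pp_mult[OF pp_mult[OF u(3,4)] xy] pp_diff_commute[of x y m] by simp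
  qed (auto simp: shell_def)
  also have "\<dots> = of_real (real q powi m) * (LINT y:shell ord 0|\<mu>. \<Phi> (b * y))"
    using integral_transversal(2)[OF U saturated_shell per] m q
    by (simp add: mult.assoc[symmetric] of_real_mult[symmetric] power_int_minus)
  also have "(LINT y:shell ord 0|\<mu>. \<Phi> (b * y)) = (LINT y:\<pp> 0|\<mu>. \<Phi> (b * y)) - (LINT y:\<pp> (0 + 1)|\<mu>. \<Phi> (b * y))"
  proof -
    obtain T where "transversal m (\<pp> 0) T" using ex_transversal[OF saturated_pp, of 0 m 0] m by auto
    hence "set_integrable \<mu> (\<pp> 0) (\<lambda>y. \<Phi> (b * y))"
      using integral_transversal(1)[OF _ saturated_pp per] m by simp
    thus ?thesis by (simp add: integral_pp_split)
  qed
  also have "\<dots> = of_bool (b \<in> \<pp> d) - of_bool (b \<in> \<pp> (d - 1)) / of_nat q"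
    unfolding integral_char by (simp add: power_int_minus inverse_eq_divide)
  finally show ?thesis .
qed

text \<open>The factors of \<open>w\<^sup>2 - \<theta>\<^sup>2\<close> are not both divisible by a uniformiser, because \<open>2\<theta>\<close> is a unit.\<close>

lemma transversal_square_roots:
  assumes \<theta>: "\<theta> \<in> shell ord 0" and m: "m \<ge> 1"
  shows "transversal m {w\<in>\<pp> 0. \<theta>\<^sup>2 - w\<^sup>2 \<in> \<pp> m} {\<theta>, - \<theta>}" "\<theta> \<noteq> - \<theta>"
proof -
  have \<theta>0: "\<theta> \<noteq> 0" "ord \<theta> = 0" "\<theta> \<in> \<pp> 0" using \<theta> by (auto simp: shell_def \<pp>_def)
  have "2 * \<theta> \<noteq> 0" "ord (2 * \<theta>) = 0" using \<theta>0 two_unit by (simp_all add: ord_mult)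
  hence "2 * \<theta> \<notin> \<pp> 1" by (simp add: pp_iff)
  hence two\<theta>: "\<theta> + \<theta> \<notin> \<pp> 1" by (simp only: mult_2 not_False_eq_True)
  hence two\<theta>m: "\<theta> + \<theta> \<notin> \<pp> m" using m pp_mono by blast
  show "\<theta> \<noteq> - \<theta>"
  proof
    assume "\<theta> = - \<theta>"
    hence "\<theta> + \<theta> = 0" by (simp only: add_eq_0_iff)
    thus False using two\<theta> by (simp only: pp_0 simp_thms)
  qed
  show "transversal m {w\<in>\<pp> 0. \<theta>\<^sup>2 - w\<^sup>2 \<in> \<pp> m} {\<theta>, - \<theta>}"
  proof (rule transversalI)
    fix w assume "w \<in> {w\<in>\<pp> 0. \<theta>\<^sup>2 - w\<^sup>2 \<in> \<pp> m}"
    hence w: "w \<in> \<pp> 0" "(w - \<theta>) * (w + \<theta>) \<in> \<pp> m"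
      using pp_diff_commute[of "\<theta>\<^sup>2" "w\<^sup>2" m] by (auto simp: power2_eq_square algebra_simps)
    have int: "w - \<theta> \<in> \<pp> 0" "w + \<theta> \<in> \<pp> 0" using pp_add pp_diff w \<theta>0 by blast+
    show "\<exists>t\<in>{\<theta>, - \<theta>}. w - t \<in> \<pp> m"
    proof (cases "w - \<theta> \<in> \<pp> 1")
      case True
      have "w + \<theta> \<notin> \<pp> 1" using pp_diff[of "w + \<theta>" 1 "w - \<theta>"] True two\<theta> by auto
      hence "w + \<theta> \<noteq> 0" "ord (w + \<theta>) = 0" using int by (auto simp: \<pp>_def)
      hence "w - \<theta> \<in> \<pp> m" using pp_mult_left_iff[of "w + \<theta>" "w - \<theta>" m] w by (simp add: mult.commute)
      thus ?thesis by simp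
    next
      case False
      hence "w - \<theta> \<noteq> 0" "ord (w - \<theta>) = 0" using int by (auto simp: \<pp>_def)
      hence "w - (- \<theta>) \<in> \<pp> m" using pp_mult_left_iff[of "w - \<theta>" "w + \<theta>" m] w by simp
      thus ?thesis by blast
    qed
  next
    fix s t assume st: "s \<in> {\<theta>, - \<theta>}" "t \<in> {\<theta>, - \<theta>}" "s - t \<in> \<pp> m"
    have "\<theta> - (- \<theta>) \<notin> \<pp> m" "- \<theta> - \<theta> \<notin> \<pp> m"
      using two\<theta>m pp_minus_iff[of "\<theta> + \<theta>" m] by simp_all
    thus "s = t" using st by blast
  qed (use \<theta>0 in auto)
qed

text \<open>Since ord c = d - m, all phases are periodic modulo \<open>\<pp> m\<close>. Three powers
  are collected: q^(-m) from turning the x-integral into a sum, q^m from the Ramanujan sum, and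
  q^(-m) from integrating w over the two cosets of \<theta> and -\<theta>.\<close>

lemma unit_shell_integral:
  assumes c: "c \<noteq> 0" "ord c = d - m" and m: "m \<ge> 1" and \<theta>: "\<theta> \<in> shell ord 0"
    and twist: "\<And>a. a \<noteq> 0 \<Longrightarrow> ord a = ord c \<Longrightarrow> gauss (\<theta> * a) = \<gamma> * gauss a"
  shows "(LINT x:shell ord 0|\<mu>. \<Phi> (c * \<theta> * (x + inverse x)) * gauss (- c * inverse x)) =
    \<gamma> * of_real (real q powi - m) * (\<Phi> (2 * c * \<theta>) + \<Phi> (- (2 * c * \<theta>)))"
proof -
  let ?f = "\<lambda>x. \<Phi> (c * \<theta> * (x + inverse x)) * gauss (- c * inverse x)"
  have q: "real q > 0" using q_ge_2 by simp
  have \<theta>0: "\<theta> \<noteq> 0" "ord \<theta> = 0" "\<theta> \<in> \<pp> 0" using \<theta> by (auto simp: shell_def \<pp>_def)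
  have cpp: "c \<in> \<pp> (d - m)" using c by (simp add: pp_iff)
  have inv: "inverse x - inverse y \<in> \<pp> m"
    if "x \<in> shell ord 0" "y \<in> shell ord 0" "x - y \<in> \<pp> m" for x y
    using inverse_add_in_pp(5)[of y 0 "x - y" m] that m by simp
  have int: "y \<in> \<pp> 0" "inverse y \<in> \<pp> 0" if "y \<in> shell ord 0" for y
    using that by (auto simp: shell_def \<pp>_def)
  have char_per: "\<Phi> (c * a) = \<Phi> (c * b)" if "a - b \<in> \<pp> m" for a b
    using pp_mult[OF cpp that] by (intro char_cong) (simp add: right_diff_distrib)
  have per: "periodic_on m (shell ord 0) ?f"
    unfolding periodic_on_def
  proof (intro ballI impI)
    fix x y assume xy: "x \<in> shell ord 0" "y \<in> shell ord 0" "x - y \<in> \<pp> m"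
    have "gauss (- c * inverse x) = gauss (- c * inverse y)"
      unfolding gauss_def
    proof (rule set_lebesgue_integral_cong)
      show "\<forall>t. t \<in> \<pp> 0 \<longrightarrow> \<Phi> (- c * inverse x * t\<^sup>2) = \<Phi> (- c * inverse y * t\<^sup>2)"
      proof (intro allI impI)
        fix t assume "t \<in> \<pp> 0"
        hence "(inverse y - inverse x) * t\<^sup>2 \<in> \<pp> m"
          using pp_mult[OF _ pp_square, of "inverse y - inverse x" m t] inv[OF xy] pp_diff_commute by fastforce
        hence "- inverse x * t\<^sup>2 - - inverse y * t\<^sup>2 \<in> \<pp> m" by (simp add: algebra_simps)
        from char_per[OF this]
        show "\<Phi> (- c * inverse x * t\<^sup>2) = \<Phi> (- c * inverse y * t\<^sup>2)" by (simp add: mult.assoc)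
      qed
    qed simp
    moreover have "\<theta> * (x + inverse x) - \<theta> * (y + inverse y) \<in> \<pp> m"
      using pp_mult[OF \<theta>0(3) pp_add[OF xy(3) inv[OF xy]]] by (simp add: algebra_simps)
    from char_per[OF this] have "\<Phi> (c * \<theta> * (x + inverse x)) = \<Phi> (c * \<theta> * (y + inverse y))"
      by (simp add: mult.assoc)
    ultimately show "?f x = ?f y" by simp
  qed
  have "shell ord 0 \<subseteq> \<pp> 0" by (auto simp: shell_iff)
  then obtain U where U: "transversal m (shell ord 0) U"
    using ex_transversal[OF saturated_shell, of 0 m 0] m by auto
  note U_shell = transversal_subset[OF U]
  \<comment> \<open>The phase left after both substitutions. It depends on y only through 1/y,
    linearly, so that the sum over y is a Ramanujan sum.\<close>
  define F where "F y w = \<Phi> (- 2 * c * w) * \<Phi> (c * (\<theta>\<^sup>2 - w\<^sup>2) * inverse y)" for y w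
  have F_per: "periodic_on m (\<pp> 0) (F y)" if y: "y \<in> shell ord 0" for y
    unfolding periodic_on_def
  proof (intro ballI impI)
    fix u w assume uw: "u \<in> \<pp> 0" "w \<in> \<pp> 0" "u - w \<in> \<pp> m"
    have F_eq: "F y w = \<Phi> (c * (- 2 * w + (\<theta>\<^sup>2 - w\<^sup>2) * inverse y))" for w
      by (simp add: F_def char_add[symmetric] algebra_simps)
    have "2 \<in> \<pp> 0" using two_unit by (simp add: pp_iff)
    hence "- 2 * (u - w) \<in> \<pp> m" using pp_mult[OF _ uw(3), of "-2" 0] by simp
    moreover have "(u - w) * (u + w) * inverse y \<in> \<pp> m"
      using pp_mult[OF pp_mult[OF uw(3) pp_add[OF uw(1,2)]] int(2)[OF y]] by simp
    ultimately have "- 2 * (u - w) - (u - w) * (u + w) * inverse y \<in> \<pp> m" by (rule pp_diff)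
    also have "- 2 * (u - w) - (u - w) * (u + w) * inverse y =
        (- 2 * u + (\<theta>\<^sup>2 - u\<^sup>2) * inverse y) - (- 2 * w + (\<theta>\<^sup>2 - w\<^sup>2) * inverse y)"
      by (simp add: power2_eq_square algebra_simps)
    finally show "F y u = F y w" unfolding F_eq by (rule char_per)
  qed
  have integrable_m: "set_integrable \<mu> A f" if A: "saturated m A" "A \<subseteq> \<pp> 0" "periodic_on m A f" for A f
  proof -
    obtain T where "transversal m A T" using ex_transversal[OF A(1,2)] m by auto
    thus ?thesis using integral_transversal(1) A by blast
  qed

  have "(LINT x:shell ord 0|\<mu>. ?f x) = of_real (real q powi - m) * (\<Sum>x\<in>U. ?f x)"
    using integral_transversal(2)[OF U saturated_shell per] m by simp
  also have "(\<Sum>x\<in>U. ?f x) = (\<Sum>y\<in>U. ?f (inverse \<theta> * y))"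
  proof (rule transversal_sum_reindex[OF U per, symmetric])
    fix x y assume "inverse \<theta> * x - inverse \<theta> * y \<in> \<pp> m"
    hence "inverse \<theta> * (x - y) \<in> \<pp> m" by (simp add: right_diff_distrib)
    thus "x - y \<in> \<pp> m" using \<theta>0 by (subst (asm) pp_mult_left_iff) auto
  qed (use \<theta>0 in \<open>auto simp: shell_def ord_mult\<close>)
  also have "\<dots> = (\<Sum>y\<in>U. \<gamma> * (LINT w:\<pp> 0|\<mu>. F y w))"
  proof (rule sum.cong)
    fix y assume "y \<in> U"
    hence y: "y \<in> shell ord 0" by (rule U_shell)
    hence y0: "y \<noteq> 0" "ord y = 0" by (auto simp: shell_def)
    have "gauss (- c * inverse (inverse \<theta> * y)) = gauss (\<theta> * (- c * inverse y))"
      using \<theta>0 by (simp add: mult_ac)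
    \<comment> \<open>The only place where \<gamma> enters; it compares two Gauss integrals whose
      arguments have the valuation of c.\<close>
    also have "\<dots> = \<gamma> * gauss (- c * inverse y)"
      by (rule twist) (use c y0 in \<open>simp_all add: ord_mult\<close>)
    also have "gauss (- c * inverse y) = (LINT w:\<pp> 0|\<mu>. \<Phi> (- c * inverse y * (w + y)\<^sup>2))"
      unfolding gauss_def by (rule set_integral_translate[symmetric]) (simp add: pp_add_cancel int y)
    finally have g: "gauss (- c * inverse (inverse \<theta> * y)) =
      \<gamma> * (LINT w:\<pp> 0|\<mu>. \<Phi> (- c * inverse y * (w + y)\<^sup>2))" .
    have arg: "c * \<theta> * (inverse \<theta> * y + inverse (inverse \<theta> * y)) = c * (y + \<theta>\<^sup>2 * inverse y)"
      using \<theta>0 by (simp add: power2_eq_square algebra_simps)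
    have F: "F y w = \<Phi> (c * (y + \<theta>\<^sup>2 * inverse y)) * \<Phi> (- c * inverse y * (w + y)\<^sup>2)" for w
      unfolding F_def char_add[symmetric] using y0
      by (intro arg_cong[of _ _ \<Phi>]) (simp add: power2_eq_square field_simps)
    show "?f (inverse \<theta> * y) = \<gamma> * (LINT w:\<pp> 0|\<mu>. F y w)"
      unfolding g arg F by simp
  qed simp
  also have "\<dots> = \<gamma> * (\<Sum>y\<in>U. LINT w:\<pp> 0|\<mu>. F y w)" by (rule sum_distrib_left[symmetric])
  also have "(\<Sum>y\<in>U. LINT w:\<pp> 0|\<mu>. F y w) = (LINT w:\<pp> 0|\<mu>. \<Sum>y\<in>U. F y w)"
    unfolding set_lebesgue_integral_def scaleR_sum_right
    using integrable_m[OF saturated_pp _ F_per] m U_shell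
    by (intro Bochner_Integration.integral_sum[symmetric]) (simp add: set_integrable_def)
  also have "\<dots> = of_real (real q powi m) * of_real (real q powi - m) * (\<Phi> (2 * c * \<theta>) + \<Phi> (- (2 * c * \<theta>)))"
  proof -
    let ?S = "\<lambda>k. {w\<in>\<pp> 0. \<theta>\<^sup>2 - w\<^sup>2 \<in> \<pp> k}"
    let ?\<chi> = "\<lambda>w. \<Phi> (- 2 * c * w)"
    have sat: "saturated k (?S k)" if "k \<ge> 0" for k
      unfolding saturated_def
    proof (intro ballI allI impI)
      fix x y assume x: "x \<in> ?S k" and yx: "y - x \<in> \<pp> k"
      have y: "y \<in> \<pp> 0" using pp_add[OF pp_mono[OF yx that], of x] x by simp
      have "(y - x) * (y + x) \<in> \<pp> k" using x pp_mult[OF yx pp_add[OF y, of x]] by simp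
      moreover have "\<theta>\<^sup>2 - x\<^sup>2 \<in> \<pp> k" using x by simp
      ultimately have "(\<theta>\<^sup>2 - x\<^sup>2) - (y - x) * (y + x) \<in> \<pp> k" by (rule pp_diff[rotated])
      thus "y \<in> ?S k" using y by (simp add: power2_eq_square algebra_simps)
    qed
    have sat': "saturated m (?S (m - 1))"
      by (rule saturated_mono[OF sat]) (use m in linarith)+
    have \<chi>_per: "periodic_on m A ?\<chi>" for A
      unfolding periodic_on_def
    proof (intro ballI impI)
      fix x y assume "x - y \<in> \<pp> m"
      hence "- 2 * x - - 2 * y \<in> \<pp> m"
        using pp_mult[of "-2" 0 "x - y" m] two_unit by (simp add: pp_iff algebra_simps)
      from char_per[OF this] show "?\<chi> x = ?\<chi> y" by (simp add: mult_ac)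
    qed
    have i1: "set_integrable \<mu> (?S m) ?\<chi>" "set_integrable \<mu> (?S (m - 1)) ?\<chi>"
      by (rule integrable_m[OF sat _ \<chi>_per] integrable_m[OF sat' _ \<chi>_per]; use m in auto)+
    have sum_F: "(\<Sum>y\<in>U. F y w) = of_real (real q powi m) *
        (of_bool (w \<in> ?S m) * ?\<chi> w - of_bool (w \<in> ?S (m - 1)) * ?\<chi> w / of_nat q)" if w: "w \<in> \<pp> 0" for w
    proof -
      have b: "c * (\<theta>\<^sup>2 - w\<^sup>2) \<in> \<pp> (d - m)"
        using pp_mult[OF cpp pp_diff[OF pp_square[OF \<theta>0(3)] pp_square[OF w]]] by simp
      have iff: "c * (\<theta>\<^sup>2 - w\<^sup>2) \<in> \<pp> d \<longleftrightarrow> w \<in> ?S m"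
        "c * (\<theta>\<^sup>2 - w\<^sup>2) \<in> \<pp> (d - 1) \<longleftrightarrow> w \<in> ?S (m - 1)"
        using w c by (simp_all add: pp_mult_left_iff)
      have "(\<Sum>y\<in>U. F y w) = ?\<chi> w * (\<Sum>y\<in>U. \<Phi> (c * (\<theta>\<^sup>2 - w\<^sup>2) * inverse y))"
        unfolding F_def by (rule sum_distrib_left[symmetric])
      also have "\<dots> = ?\<chi> w * (of_real (real q powi m) *
          (of_bool (w \<in> ?S m) - of_bool (w \<in> ?S (m - 1)) / of_nat q))"
        unfolding sum_units_char[OF U m b] iff ..
      finally show ?thesis by (simp only: right_diff_distrib mult_ac times_divide_eq_right)
    qed
    \<comment> \<open>The second term of the Ramanujan sum drops out: \<open>?S (m - 1)\<close> is
      invariant under \<open>\<pp> (m - 1)\<close>, where \<open>?\<chi>\<close> is non-trivial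
      because ord (2c) = d - m. For m = 1 this set is all of \<open>\<pp> 0\<close>.\<close>
    have zero: "(LINT w:?S (m - 1)|\<mu>. ?\<chi> w) = 0"
    proof -
      have "2 * c \<noteq> 0" "ord (2 * c) = d - m" using c two_unit by (simp_all add: ord_mult)
      hence "- 2 * c \<notin> \<pp> (d - (m - 1))" using pp_minus_iff[of "2 * c"] by (simp add: pp_iff)
      then obtain h where h: "h \<in> \<pp> (m - 1)" "\<Phi> (- 2 * c * h) \<noteq> 1" by (rule char_scaled_nontrivial)
      have S: "saturated (m - 1) (?S (m - 1))" by (rule sat) (use m in linarith)
      have h': "w - (w + h) \<in> \<pp> (m - 1)" "(w + h) - w \<in> \<pp> (m - 1)" for w using h(1) by simp_all
      have "w + h \<in> ?S (m - 1) \<longleftrightarrow> w \<in> ?S (m - 1)" for w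
        by (rule iffI; rule saturatedD[OF S _ h'(1)] saturatedD[OF S _ h'(2)])
      hence "(LINT w:?S (m - 1)|\<mu>. ?\<chi> w) = (LINT w:?S (m - 1)|\<mu>. ?\<chi> (w + h))"
        by (rule set_integral_translate[symmetric])
      also have "\<dots> = ?\<chi> h * (LINT w:?S (m - 1)|\<mu>. ?\<chi> w)"
        by (simp only: distrib_left char_add mult.commute[of _ "?\<chi> h"] set_integral_mult_right)
      finally show ?thesis using h(2) by (simp add: mult_cancel_right1)
    qed
    have "(LINT w:\<pp> 0|\<mu>. \<Sum>y\<in>U. F y w) = (LINT w|\<mu>. of_real (real q powi m) *
        (indicator (?S m) w *\<^sub>R ?\<chi> w - indicator (?S (m - 1)) w *\<^sub>R ?\<chi> w / of_nat q))"
      unfolding set_lebesgue_integral_def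
    proof (rule Bochner_Integration.integral_cong)
      fix w
      show "indicator (\<pp> 0) w *\<^sub>R (\<Sum>y\<in>U. F y w) = of_real (real q powi m) *
        (indicator (?S m) w *\<^sub>R ?\<chi> w - indicator (?S (m - 1)) w *\<^sub>R ?\<chi> w / of_nat q)"
        using sum_F[of w] by (cases "w \<in> \<pp> 0") (simp_all add: indicator_def)
    qed simp
    also have "\<dots> = of_real (real q powi m) * ((LINT w:?S m|\<mu>. ?\<chi> w) - (LINT w:?S (m - 1)|\<mu>. ?\<chi> w) / of_nat q)"
      using i1 unfolding set_lebesgue_integral_def set_integrable_def
      by (simp only: integral_mult_right_zero Bochner_Integration.integral_diff integrable_divide_zero
          integrable_divide integral_divide_zero)
    also have "(LINT w:?S m|\<mu>. ?\<chi> w) = of_real (real q powi - m) * (\<Phi> (2 * c * \<theta>) + \<Phi> (- (2 * c * \<theta>)))"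
      using integral_transversal(2)[OF transversal_square_roots(1)[OF \<theta> m] sat \<chi>_per] m
        transversal_square_roots(2)[OF \<theta> m] by (simp add: add.commute)
    finally show ?thesis by (simp only: zero) simp
  qed
  also have "of_real (real q powi m) * of_real (real q powi - m) = (1 :: complex)"
    using q by (simp add: power_int_minus flip: of_real_mult)
  finally show ?thesis by simp
qed

lemma mock_fourier_eq:
  assumes c: "c = \<beta> * s" "c \<noteq> 0" "ord c = d - m" and m: "m \<ge> 1" and \<theta>: "\<theta> \<in> shell ord 0"
    and twist: "\<And>a. a \<noteq> 0 \<Longrightarrow> ord a = ord c \<Longrightarrow> gauss (\<theta> * a) = \<gamma> * gauss a"
  shows "mock_fourier ord \<mu> \<Phi> \<beta> \<theta> s \<theta> =
    \<gamma> * of_real (real q powi - m) * (\<Phi> (2 * c * \<theta>) + \<Phi> (- (2 * c * \<theta>)))"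
proof -
  let ?f = "\<lambda>x. indicator (norm_group \<theta>) x * (\<Phi> (c * \<theta> * (x + inverse x)) * inner_sum c x)"
  have "mock_fourier ord \<mu> \<Phi> \<beta> \<theta> s \<theta> = (\<Sum>\<^sub>\<infinity>n\<in>UNIV. LINT x:shell ord n|mult_haar ord \<mu>. ?f x)"
    unfolding mock_fourier_def c(1)[symmetric] infsum_shell_factor ..
  also have "\<dots> = (\<Sum>\<^sub>\<infinity>n\<in>{0}. LINT x:shell ord n|mult_haar ord \<mu>. ?f x)"
    using outer_shell_eq_0[OF c(2) _ \<theta>] c(3) m by (intro infsum_cong_neutral) auto
  also have "\<dots> = (LINT x:shell ord 0|\<mu>. ?f x)"
    by (simp add: integral_mult_haar_shell)
  also have "\<dots> = (LINT x:shell ord 0|\<mu>. \<Phi> (c * \<theta> * (x + inverse x)) * gauss (- c * inverse x))"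
  proof (rule set_lebesgue_integral_cong)
    show "\<forall>x. x \<in> shell ord 0 \<longrightarrow> ?f x = \<Phi> (c * \<theta> * (x + inverse x)) * gauss (- c * inverse x)"
    proof (intro allI impI)
      fix x assume x: "x \<in> shell ord 0"
      hence "inner_sum c x = gauss (- c * inverse x)"
        unfolding inner_sum_def using c m by (intro infsum_gauss) (auto simp: shell_def ord_mult)
      thus "?f x = \<Phi> (c * \<theta> * (x + inverse x)) * gauss (- c * inverse x)"
        using unit_in_norm_group[OF \<theta> x] by simp
    qed
  qed simp
  also have "\<dots> = \<gamma> * of_real (real q powi - m) * (\<Phi> (2 * c * \<theta>) + \<Phi> (- (2 * c * \<theta>)))"
    by (rule unit_shell_integral[OF c(2,3) m \<theta> twist])
  finally show ?thesis .
qed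

end

section \<open>The torus and its Weyl group\<close>

lemma mat2_nth [simp]:
  "mat2 a b c d $ 1 $ 1 = a" "mat2 a b c d $ 1 $ 2 = b" "mat2 a b c d $ 2 $ 1 = c" "mat2 a b c d $ 2 $ 2 = d"
  by (simp_all add: mat2_def)

lemma mat2_collapse: "mat2 (A $ 1 $ 1) (A $ 1 $ 2) (A $ 2 $ 1) (A $ 2 $ 2) = A"
  by (simp add: vec_eq_iff forall_2)

lemma mat2_eq_iff [simp]: "mat2 a b c d = mat2 a' b' c' d' \<longleftrightarrow> a = a' \<and> b = b' \<and> c = c' \<and> d = d'"
  by (auto simp: vec_eq_iff forall_2)

lemma mat2_mult [simp]:
  "mat2 a b c d ** mat2 a' b' c' d' = mat2 (a * a' + b * c') (a * b' + b * d') (c * a' + d * c') (c * b' + d * d')"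
  by (simp add: vec_eq_iff forall_2 matrix_matrix_mult_def sum_2)

lemma det_mat2 [simp]: "det (mat2 a b c d) = a * d - b * c"
  by (simp add: det_2)

lemma trace_mat2 [simp]: "trace (mat2 a b c d) = a + d"
  by (simp add: trace_def sum_2)

lemma mat_1_eq_mat2: "mat 1 = mat2 1 0 0 1"
  by (simp add: vec_eq_iff forall_2 mat_def)

lemma SL2_sel [simp]:
  "carrier SL2 = {A. det A = 1}" "x \<otimes>\<^bsub>SL2\<^esub> y = x ** y" "\<one>\<^bsub>SL2\<^esub> = mat 1"
  by (simp_all add: SL2_def)

lemma group_SL2: "group (SL2 :: ('k::field ^ 2 ^ 2) monoid)"
proof (rule groupI)
  fix A :: "'k ^ 2 ^ 2" assume "A \<in> carrier SL2"
  moreover obtain a b c d where A: "A = mat2 a b c d" using mat2_collapse by metis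
  ultimately have "mat2 d (- b) (- c) a ** A = mat 1" "det (mat2 d (- b) (- c) a) = 1"
    by (simp_all add: mat_1_eq_mat2 algebra_simps)
  thus "\<exists>B\<in>carrier SL2. B \<otimes>\<^bsub>SL2\<^esub> A = \<one>\<^bsub>SL2\<^esub>" by (intro bexI[of _ "mat2 d (- b) (- c) a"]) simp_all
qed (simp_all add: det_mul matrix_mul_assoc)

lemma inv_SL2:
  fixes a b c d :: "'k::field"
  assumes "a * d - b * c = 1"
  shows "inv\<^bsub>SL2\<^esub> (mat2 a b c d) = mat2 d (- b) (- c) a"
  using assms by (intro group.inv_equality[OF group_SL2]) (simp_all add: mat_1_eq_mat2 algebra_simps)

text \<open>The matrices of determinant 1 that anticommute with the matrix \<surd>\<theta>; they
  will form the non-trivial coset of the torus in its normaliser. The condition on p and q says that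
  -1 is a norm.\<close>

definition inverting :: "'k::field \<Rightarrow> ('k ^ 2 ^ 2) set" where
  "inverting \<theta> = {mat2 p q (- q * \<theta>) (- p) | p q. q\<^sup>2 * \<theta> - p\<^sup>2 = 1}"

lemma torus_subset_SL2: "torus \<theta> \<subseteq> carrier SL2"
  by (auto simp: torus_def power2_eq_square mult_ac)

text \<open>No relation is imposed on a and b, so the formulas apply to the torus and, with a = 0,
  to its Lie algebra.\<close>

lemma conjugate_torus_elt:
  fixes \<theta> :: "'k::field"
  shows "g \<in> torus \<theta> \<Longrightarrow> g ** mat2 a b (b * \<theta>) a ** inv\<^bsub>SL2\<^esub> g = mat2 a b (b * \<theta>) a"
    and "g \<in> inverting \<theta> \<Longrightarrow> g ** mat2 a b (b * \<theta>) a ** inv\<^bsub>SL2\<^esub> g = mat2 a (- b) (- b * \<theta>) a"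
proof -
  assume "g \<in> torus \<theta>"
  then obtain p q where g: "g = mat2 p q (q * \<theta>) p" and pq: "p\<^sup>2 - q\<^sup>2 * \<theta> = 1" by (auto simp: torus_def)
  have inv: "inv\<^bsub>SL2\<^esub> g = mat2 p (- q) (- (q * \<theta>)) p"
    unfolding g using pq by (intro inv_SL2) (simp add: power2_eq_square mult_ac)
  have "g ** mat2 a b (b * \<theta>) a ** inv\<^bsub>SL2\<^esub> g = mat2 (a * (p\<^sup>2 - q\<^sup>2 * \<theta>)) (b * (p\<^sup>2 - q\<^sup>2 * \<theta>))
      (b * \<theta> * (p\<^sup>2 - q\<^sup>2 * \<theta>)) (a * (p\<^sup>2 - q\<^sup>2 * \<theta>))"
    unfolding inv unfolding g by (simp add: power2_eq_square algebra_simps)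
  thus "g ** mat2 a b (b * \<theta>) a ** inv\<^bsub>SL2\<^esub> g = mat2 a b (b * \<theta>) a" by (simp only: pq mult_1_right)
next
  assume "g \<in> inverting \<theta>"
  then obtain p q where g: "g = mat2 p q (- q * \<theta>) (- p)" and pq: "q\<^sup>2 * \<theta> - p\<^sup>2 = 1"
    by (auto simp: inverting_def)
  have inv: "inv\<^bsub>SL2\<^esub> g = mat2 (- p) (- q) (q * \<theta>) p"
    unfolding g using pq inv_SL2[of p "- p" q "- q * \<theta>"] by (simp add: power2_eq_square algebra_simps)
  have "g ** mat2 a b (b * \<theta>) a ** inv\<^bsub>SL2\<^esub> g = mat2 (a * (q\<^sup>2 * \<theta> - p\<^sup>2)) (- b * (q\<^sup>2 * \<theta> - p\<^sup>2))
      (- b * \<theta> * (q\<^sup>2 * \<theta> - p\<^sup>2)) (a * (q\<^sup>2 * \<theta> - p\<^sup>2))"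
    unfolding inv unfolding g by (simp add: power2_eq_square algebra_simps)
  thus "g ** mat2 a b (b * \<theta>) a ** inv\<^bsub>SL2\<^esub> g = mat2 a (- b) (- b * \<theta>) a" by (simp only: pq mult_1_right)
qed

section \<open>The normaliser of the torus and its cosets\<close>

lemma coset_SL2: "g <#\<^bsub>SL2\<^esub> H #>\<^bsub>SL2\<^esub> h = (\<lambda>t. g ** t ** h) ` H"
  by (auto simp: l_coset_def r_coset_def)

lemma normalizer_torus_iff:
  "g \<in> normalizer SL2 (torus \<theta>) \<longleftrightarrow>
    det g = 1 \<and> (\<lambda>t. g ** t ** inv\<^bsub>SL2\<^esub> g) ` torus \<theta> = torus \<theta>"
  using torus_subset_SL2[of \<theta>] by (simp add: normalizer_def stabilizer_def coset_SL2)

text \<open>For the inclusion from left to right one torus element with b non-zero is enough: where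
  it is sent by conjugation already determines the shape of g.\<close>

lemma normalizer_torus:
  fixes \<theta> :: "'k::field"
  assumes two: "(2 :: 'k) \<noteq> 0" and \<theta>: "\<theta> \<noteq> 0" and ab: "a\<^sup>2 - b\<^sup>2 * \<theta> = 1" "b \<noteq> 0"
  shows "normalizer SL2 (torus \<theta>) = torus \<theta> \<union> inverting \<theta>"
proof (intro equalityI subsetI)
  fix g assume "g \<in> normalizer SL2 (torus \<theta>)"
  hence g: "det g = 1" "(\<lambda>t. g ** t ** inv\<^bsub>SL2\<^esub> g) ` torus \<theta> = torus \<theta>"
    by (simp_all add: normalizer_torus_iff)
  obtain p q r s where pq: "g = mat2 p q r s" using mat2_collapse by metis
  have det: "p * s - q * r = 1" using g(1) pq by simp
  have "mat2 a b (b * \<theta>) a \<in> torus \<theta>" using ab by (auto simp: torus_def)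
  hence "g ** mat2 a b (b * \<theta>) a ** inv\<^bsub>SL2\<^esub> g \<in> torus \<theta>" using g(2) by blast
  then obtain a' b' where eq: "g ** mat2 a b (b * \<theta>) a ** inv\<^bsub>SL2\<^esub> g = mat2 a' b' (b' * \<theta>) a'"
    by (auto simp: torus_def)
  \<comment> \<open>Conjugation by g sends \<surd>\<theta> to a matrix with diagonal u, -u and upper
    right entry l. Membership in the torus forces u = 0, so \<surd>\<theta> goes to l
    \<surd>\<theta>; the determinant then yields l^2 = 1, with l = 1 for \<open>torus\<close> and l
    = -1 for \<open>inverting\<close>.\<close>
  define u where "u = q * \<theta> * s - p * r"
  define l where "l = p\<^sup>2 - q\<^sup>2 * \<theta>"
  have "g ** mat2 a b (b * \<theta>) a ** inv\<^bsub>SL2\<^esub> g = mat2 (a * (p * s - q * r) + b * u) (b * l)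
      (b * (s\<^sup>2 * \<theta> - r\<^sup>2)) (a * (p * s - q * r) - b * u)"
    unfolding pq inv_SL2[OF det] by (simp add: u_def l_def power2_eq_square algebra_simps)
  hence "b * u = - (b * u)" "b * (s\<^sup>2 * \<theta> - r\<^sup>2) = b * (l * \<theta>)"
    using eq det by (auto simp: algebra_simps)
  hence "2 * (b * u) = 0" "s\<^sup>2 * \<theta> - r\<^sup>2 = l * \<theta>" using ab(2) by (simp_all only: mult_2 mult_cancel_left eq_neg_iff_add_eq_0 simp_thms)
  hence u: "q * \<theta> * s = p * r" and sr: "s\<^sup>2 * \<theta> - r\<^sup>2 = l * \<theta>"
    using two ab(2) by (simp_all add: u_def)
  have "l * s = p * (p * s) - q * (q * \<theta> * s)" by (simp add: l_def power2_eq_square algebra_simps)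
  also have "\<dots> = p * (p * s - q * r)" unfolding u by (simp add: algebra_simps)
  finally have ls: "l * s = p" using det by simp
  have "l * r = p * (p * r) - q\<^sup>2 * \<theta> * r" by (simp add: l_def power2_eq_square algebra_simps)
  also have "\<dots> = q * \<theta> * (p * s - q * r)" unfolding u[symmetric] by (simp add: power2_eq_square algebra_simps)
  finally have lr: "l * r = q * \<theta>" using det by simp
  have "l \<noteq> 0" using ls lr \<theta> det by auto
  have "l\<^sup>2 * (l * \<theta>) = (l * s)\<^sup>2 * \<theta> - (l * r)\<^sup>2"
    unfolding sr[symmetric] by (simp add: power_mult_distrib algebra_simps)
  also have "\<dots> = l * \<theta>" unfolding ls lr by (simp add: l_def power2_eq_square algebra_simps)
  finally have "l\<^sup>2 = 1" using \<open>l \<noteq> 0\<close> \<theta> by simp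
  hence "l = 1 \<or> l = -1" by (simp add: power2_eq_1_iff)
  thus "g \<in> torus \<theta> \<union> inverting \<theta>"
  proof
    assume "l = 1"
    hence "g = mat2 p q (q * \<theta>) p" "p\<^sup>2 - q\<^sup>2 * \<theta> = 1" using ls lr pq by (simp_all add: l_def)
    thus ?thesis by (auto simp: torus_def)
  next
    assume l: "l = -1"
    have "s = - p" by (simp add: ls[symmetric] l)
    moreover have "r = - (q * \<theta>)" by (simp add: lr[symmetric] l)
    moreover have "q\<^sup>2 * \<theta> - p\<^sup>2 = - l" by (simp add: l_def)
    ultimately have "g = mat2 p q (- q * \<theta>) (- p)" "q\<^sup>2 * \<theta> - p\<^sup>2 = 1" using pq l by simp_all
    thus ?thesis by (auto simp: inverting_def)
  qed
next
  fix g assume "g \<in> torus \<theta> \<union> inverting \<theta>"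
  thus "g \<in> normalizer SL2 (torus \<theta>)"
  proof
    assume g: "g \<in> torus \<theta>"
    hence "det g = 1" using torus_subset_SL2 by auto
    moreover have "g ** t ** inv\<^bsub>SL2\<^esub> g = t" if "t \<in> torus \<theta>" for t
      using that conjugate_torus_elt(1)[OF g] by (auto simp: torus_def)
    hence "(\<lambda>t. g ** t ** inv\<^bsub>SL2\<^esub> g) ` torus \<theta> = torus \<theta>" by simp
    ultimately show ?thesis by (simp add: normalizer_torus_iff)
  next
    assume g: "g \<in> inverting \<theta>"
    hence "det g = 1" by (auto simp: inverting_def power2_eq_square algebra_simps)
    moreover have "(\<lambda>t. g ** t ** inv\<^bsub>SL2\<^esub> g) ` torus \<theta> = torus \<theta>"
    proof (intro equalityI subsetI)
      fix t assume "t \<in> torus \<theta>"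
      then obtain x y where t: "t = mat2 x y (y * \<theta>) x" "x\<^sup>2 - y\<^sup>2 * \<theta> = 1" by (auto simp: torus_def)
      have "t = g ** mat2 x (- y) (- y * \<theta>) x ** inv\<^bsub>SL2\<^esub> g"
        unfolding conjugate_torus_elt(2)[OF g] t(1) by simp
      moreover have "mat2 x (- y) (- y * \<theta>) x \<in> torus \<theta>"
        unfolding torus_def using t(2) by (intro CollectI exI[of _ x] exI[of _ "- y"]) simp
      ultimately show "t \<in> (\<lambda>t. g ** t ** inv\<^bsub>SL2\<^esub> g) ` torus \<theta>" by blast
    next
      fix t assume "t \<in> (\<lambda>t. g ** t ** inv\<^bsub>SL2\<^esub> g) ` torus \<theta>"
      then obtain x y where "t = g ** mat2 x y (y * \<theta>) x ** inv\<^bsub>SL2\<^esub> g" "x\<^sup>2 - y\<^sup>2 * \<theta> = 1"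
        by (auto simp: torus_def)
      thus "t \<in> torus \<theta>"
        unfolding conjugate_torus_elt(2)[OF g] torus_def
        by (intro CollectI exI[of _ x] exI[of _ "- y"]) simp
    qed
    ultimately show ?thesis by (simp add: normalizer_torus_iff)
  qed
qed

text \<open>All four inclusions rest on multiplicativity of the norm form; the witnesses
  \<open>?x\<close> and \<open>?y\<close> are the first row of t times the inverse of g.\<close>

lemma torus_translate:
  fixes \<theta> :: "'k::field"
  shows "g \<in> torus \<theta> \<Longrightarrow> (\<lambda>t. t ** g) ` torus \<theta> = torus \<theta>"
    and "g \<in> inverting \<theta> \<Longrightarrow> (\<lambda>t. t ** g) ` torus \<theta> = inverting \<theta>"
proof -
  assume "g \<in> torus \<theta>"
  then obtain p q where g: "g = mat2 p q (q * \<theta>) p" and pq: "p\<^sup>2 - q\<^sup>2 * \<theta> = 1" by (auto simp: torus_def)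
  show "(\<lambda>t. t ** g) ` torus \<theta> = torus \<theta>"
  proof (intro equalityI subsetI)
    fix t assume "t \<in> (\<lambda>t. t ** g) ` torus \<theta>"
    then obtain x y where t: "t = mat2 x y (y * \<theta>) x ** g" and xy: "x\<^sup>2 - y\<^sup>2 * \<theta> = 1" by (auto simp: torus_def)
    have "(x * p + y * q * \<theta>)\<^sup>2 - (x * q + y * p)\<^sup>2 * \<theta> = (x\<^sup>2 - y\<^sup>2 * \<theta>) * (p\<^sup>2 - q\<^sup>2 * \<theta>)"
      by (simp add: power2_eq_square algebra_simps)
    thus "t \<in> torus \<theta>" unfolding torus_def t g pq xy
      by (intro CollectI exI[of _ "x * p + y * q * \<theta>"] exI[of _ "x * q + y * p"]) (simp add: algebra_simps)
  next
    fix t assume "t \<in> torus \<theta>"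
    then obtain x y where t: "t = mat2 x y (y * \<theta>) x" and xy: "x\<^sup>2 - y\<^sup>2 * \<theta> = 1" by (auto simp: torus_def)
    let ?x = "x * p - y * q * \<theta>" and ?y = "y * p - x * q"
    have "?x\<^sup>2 - ?y\<^sup>2 * \<theta> = (x\<^sup>2 - y\<^sup>2 * \<theta>) * (p\<^sup>2 - q\<^sup>2 * \<theta>)"
      by (simp add: power2_eq_square algebra_simps)
    hence "mat2 ?x ?y (?y * \<theta>) ?x \<in> torus \<theta>" unfolding torus_def pq xy by auto
    moreover have "mat2 ?x ?y (?y * \<theta>) ?x ** g = mat2 (x * (p\<^sup>2 - q\<^sup>2 * \<theta>)) (y * (p\<^sup>2 - q\<^sup>2 * \<theta>))
        (y * (p\<^sup>2 - q\<^sup>2 * \<theta>) * \<theta>) (x * (p\<^sup>2 - q\<^sup>2 * \<theta>))"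
      unfolding g by (simp add: power2_eq_square algebra_simps)
    hence "t = mat2 ?x ?y (?y * \<theta>) ?x ** g" unfolding t pq by simp
    ultimately show "t \<in> (\<lambda>t. t ** g) ` torus \<theta>" by blast
  qed
next
  assume "g \<in> inverting \<theta>"
  then obtain p q where g: "g = mat2 p q (- q * \<theta>) (- p)" and pq: "q\<^sup>2 * \<theta> - p\<^sup>2 = 1"
    by (auto simp: inverting_def)
  show "(\<lambda>t. t ** g) ` torus \<theta> = inverting \<theta>"
  proof (intro equalityI subsetI)
    fix t assume "t \<in> (\<lambda>t. t ** g) ` torus \<theta>"
    then obtain x y where t: "t = mat2 x y (y * \<theta>) x ** g" and xy: "x\<^sup>2 - y\<^sup>2 * \<theta> = 1" by (auto simp: torus_def)
    have "(x * q - y * p)\<^sup>2 * \<theta> - (x * p - y * q * \<theta>)\<^sup>2 = (x\<^sup>2 - y\<^sup>2 * \<theta>) * (q\<^sup>2 * \<theta> - p\<^sup>2)"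
      by (simp add: power2_eq_square algebra_simps)
    thus "t \<in> inverting \<theta>" unfolding inverting_def t g pq xy
      by (intro CollectI exI[of _ "x * p - y * q * \<theta>"] exI[of _ "x * q - y * p"]) (simp add: algebra_simps)
  next
    fix t assume "t \<in> inverting \<theta>"
    then obtain x y where t: "t = mat2 x y (- y * \<theta>) (- x)" and xy: "y\<^sup>2 * \<theta> - x\<^sup>2 = 1"
      by (auto simp: inverting_def)
    let ?x = "y * q * \<theta> - x * p" and ?y = "y * p - x * q"
    have "?x\<^sup>2 - ?y\<^sup>2 * \<theta> = (y\<^sup>2 * \<theta> - x\<^sup>2) * (q\<^sup>2 * \<theta> - p\<^sup>2)"
      by (simp add: power2_eq_square algebra_simps)
    hence "mat2 ?x ?y (?y * \<theta>) ?x \<in> torus \<theta>" unfolding torus_def pq xy by auto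
    moreover have "mat2 ?x ?y (?y * \<theta>) ?x ** g = mat2 (x * (q\<^sup>2 * \<theta> - p\<^sup>2)) (y * (q\<^sup>2 * \<theta> - p\<^sup>2))
        (- y * (q\<^sup>2 * \<theta> - p\<^sup>2) * \<theta>) (- x * (q\<^sup>2 * \<theta> - p\<^sup>2))"
      unfolding g by (simp add: power2_eq_square algebra_simps)
    hence "t = mat2 ?x ?y (?y * \<theta>) ?x ** g" unfolding t pq by simp
    ultimately show "t \<in> (\<lambda>t. t ** g) ` torus \<theta>" by blast
  qed
qed

lemma inverting_disjoint:
  fixes \<theta> :: "'k::field"
  assumes two: "(2 :: 'k) \<noteq> 0" and \<theta>: "\<theta> \<noteq> 0"
  shows "torus \<theta> \<inter> inverting \<theta> = {}"
proof (rule equals0I)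
  fix g assume "g \<in> torus \<theta> \<inter> inverting \<theta>"
  then obtain p q where "p = - p" "q * \<theta> = - (q * \<theta>)" and pq: "q\<^sup>2 * \<theta> - p\<^sup>2 = 1"
    by (auto simp: torus_def inverting_def)
  hence "p + p = 0" "q * \<theta> + q * \<theta> = 0" by (simp_all only: add_eq_0_iff)
  hence "2 * p = 0" "2 * (q * \<theta>) = 0" by (simp_all only: mult_2)
  hence "p = 0" "q = 0" using two \<theta> by simp_all
  thus False using pq by simp
qed

section \<open>The Weyl group and its action on functionals\<close>

lemma carrier_weyl_group:
  fixes \<theta> :: "'k::field"
  assumes "(2 :: 'k) \<noteq> 0" "\<theta> \<noteq> 0" "a\<^sup>2 - b\<^sup>2 * \<theta> = 1" "b \<noteq> 0" and w: "w \<in> inverting \<theta>"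
  shows "carrier (weyl_group (torus \<theta>)) = {torus \<theta>, inverting \<theta>}"
proof -
  have "carrier (weyl_group (torus \<theta>)) = (\<lambda>g. (\<lambda>t. t ** g) ` torus \<theta>) ` (torus \<theta> \<union> inverting \<theta>)"
    unfolding weyl_group_def FactGroup_def RCOSETS_def normalizer_torus[OF assms(1-4)]
    by (auto simp: r_coset_def)
  also have "\<dots> = {torus \<theta>, inverting \<theta>}"
  proof -
    have "mat2 1 0 (0 * \<theta>) 1 \<in> torus \<theta>" unfolding torus_def by fastforce
    thus ?thesis using w torus_translate[of _ \<theta>] by (auto simp: image_Un)
  qed
  finally show ?thesis .
qed

lemma dual_of_lie_elt: "dual_of (lie_elt \<beta> \<theta>) (lie_elt s \<theta>) = 2 * (\<beta> * s) * (\<theta> :: 'k::field)"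
  by (simp add: dual_of_def lie_elt_def algebra_simps)

lemma weyl_sum:
  fixes \<theta> \<beta> s :: "'k::field" and \<Phi> :: "'k \<Rightarrow> complex"
  assumes two: "(2 :: 'k) \<noteq> 0" and \<theta>: "\<theta> \<noteq> 0" and ab: "a\<^sup>2 - b\<^sup>2 * \<theta> = 1" "b \<noteq> 0"
    and w: "w \<in> inverting \<theta>"
  shows "(\<Sum>\<sigma>\<in>carrier (weyl_group (torus \<theta>)). \<Phi> (weyl_coadjoint \<sigma> (dual_of (lie_elt \<beta> \<theta>)) (lie_elt s \<theta>))) =
    \<Phi> (2 * (\<beta> * s) * \<theta>) + \<Phi> (- (2 * (\<beta> * s) * \<theta>))"
proof -
  \<comment> \<open>The coadjoint action conjugates with the inverse on the left. Both cosets are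
    closed under inversion, so the conjugation formulas can be applied to the inverse of g; they
    hold for every element of a coset, hence for the chosen one.\<close>
  have inv_inv: "inv\<^bsub>SL2\<^esub> (inv\<^bsub>SL2\<^esub> g) = g" "inv\<^bsub>SL2\<^esub> g \<in> A"
    if gA: "g \<in> A" "A = torus \<theta> \<or> A = inverting \<theta>" for g A
  proof -
    have "g \<in> carrier SL2"
      using gA torus_subset_SL2[of \<theta>] by (auto simp: inverting_def power2_eq_square algebra_simps)
    thus "inv\<^bsub>SL2\<^esub> (inv\<^bsub>SL2\<^esub> g) = g" by (rule group.inv_inv[OF group_SL2])
    show "inv\<^bsub>SL2\<^esub> g \<in> A"
      using gA(2)
    proof
      assume A: "A = torus \<theta>"
      then obtain p q where g: "g = mat2 p q (q * \<theta>) p" "p\<^sup>2 - q\<^sup>2 * \<theta> = 1"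
        using gA(1) by (auto simp: torus_def)
      have "inv\<^bsub>SL2\<^esub> g = mat2 p (- q) (- q * \<theta>) p"
        unfolding g(1) using g(2) by (subst inv_SL2) (simp_all add: power2_eq_square mult_ac)
      thus ?thesis unfolding A torus_def using g(2)
        by (intro CollectI exI[of _ p] exI[of _ "- q"]) simp
    next
      assume A: "A = inverting \<theta>"
      then obtain p q where g: "g = mat2 p q (- q * \<theta>) (- p)" "q\<^sup>2 * \<theta> - p\<^sup>2 = 1"
        using gA(1) by (auto simp: inverting_def)
      have "inv\<^bsub>SL2\<^esub> g = mat2 (- p) (- q) (- (- q) * \<theta>) (- (- p))"
        unfolding g(1) using g(2) by (subst inv_SL2) (simp_all add: power2_eq_square algebra_simps)
      thus ?thesis unfolding A inverting_def using g(2)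
        by (intro CollectI exI[of _ "- p"] exI[of _ "- q"]) simp
    qed
  qed
  have "weyl_coadjoint (torus \<theta>) (dual_of (lie_elt \<beta> \<theta>)) (lie_elt s \<theta>) = 2 * (\<beta> * s) * \<theta>"
  proof -
    have "mat2 1 0 (0 * \<theta>) 1 \<in> torus \<theta>" unfolding torus_def by fastforce
    hence g: "(SOME g. g \<in> torus \<theta>) \<in> torus \<theta>" by (rule someI)
    show ?thesis
      using conjugate_torus_elt(1)[OF inv_inv(2)[OF g], of 0 s] inv_inv(1)[OF g]
      by (simp add: weyl_coadjoint_def coadjoint_def dual_of_lie_elt flip: lie_elt_def)
  qed
  moreover have "weyl_coadjoint (inverting \<theta>) (dual_of (lie_elt \<beta> \<theta>)) (lie_elt s \<theta>) = - (2 * (\<beta> * s) * \<theta>)"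
  proof -
    have g: "(SOME g. g \<in> inverting \<theta>) \<in> inverting \<theta>" using w by (rule someI)
    let ?g = "SOME g. g \<in> inverting \<theta>"
    have "inv\<^bsub>SL2\<^esub> ?g ** lie_elt s \<theta> ** ?g = lie_elt (- s) \<theta>"
      using conjugate_torus_elt(2)[OF inv_inv(2)[OF g], of 0 s] inv_inv(1)[OF g]
      by (simp add: lie_elt_def)
    thus ?thesis by (simp add: weyl_coadjoint_def coadjoint_def dual_of_lie_elt)
  qed
  \<comment> \<open>Without this the two-element set could collapse and the sum would have one
    term.\<close>
  moreover have "torus \<theta> \<noteq> inverting \<theta>" using inverting_disjoint[OF two \<theta>] w by blast
  ultimately show ?thesis unfolding carrier_weyl_group[OF assms] by simp
qed

section \<open>Rational points on the torus and on its non-trivial coset\<close>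

context local_field
begin

text \<open>The rational parametrisation of the conic a^2 - b^2 \<theta> = 1. Taking the parameter
  of valuation 1 keeps the denominator 1 - \<theta> m^2 away from zero and b non-zero.\<close>

lemma ex_torus_elt:
  assumes "\<theta> \<in> shell ord 0"
  obtains a b where "a\<^sup>2 - b\<^sup>2 * \<theta> = 1" "b \<noteq> 0"
proof -
  have \<theta>: "\<theta> \<noteq> 0" "ord \<theta> = 0" using assms by (auto simp: shell_def)
  obtain m where m: "m \<noteq> 0" "ord m = 1" using ex_ord .
  define e where "e = 1 - \<theta> * m\<^sup>2"
  have "e \<noteq> 0"
    unfolding e_def using ord_add_eq(1)[of 1 "- (\<theta> * m\<^sup>2)"] \<theta> m by (simp add: pp_iff ord_mult ord_power2)
  have "(1 + \<theta> * m\<^sup>2)\<^sup>2 - (2 * m)\<^sup>2 * \<theta> = e\<^sup>2" by (simp add: e_def power2_eq_square algebra_simps)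
  hence "((1 + \<theta> * m\<^sup>2) / e)\<^sup>2 - (2 * m / e)\<^sup>2 * \<theta> = 1"
    using \<open>e \<noteq> 0\<close> by (simp add: power_divide diff_divide_distrib[symmetric])
  moreover have "2 * m / e \<noteq> 0" using two_unit m \<open>e \<noteq> 0\<close> by simp
  ultimately show ?thesis by (rule that)
qed

text \<open>The ratio of the off-diagonal entries of an element with b non-zero recovers \<theta>,
  so a common torus means the same parameter and not merely the same square class.\<close>

lemma torus_eq_imp_eq:
  assumes "\<theta> \<in> shell ord 0" "torus \<theta> = torus \<theta>'"
  shows "\<theta> = \<theta>'"
proof -
  obtain a b where ab: "a\<^sup>2 - b\<^sup>2 * \<theta> = 1" "b \<noteq> 0" using ex_torus_elt[OF assms(1)] .
  have "mat2 a b (b * \<theta>) a \<in> torus \<theta>'" unfolding assms(2)[symmetric] using ab by (auto simp: torus_def)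
  thus ?thesis using ab(2) by (auto simp: torus_def)
qed

lemma ex_inverting:
  assumes "\<theta> \<in> shell ord 0"
  shows "\<exists>w. w \<in> inverting \<theta>"
proof -
  have "-1 \<in> shell ord 0" by (simp add: shell_def)
  hence "-1 \<in> norm_group \<theta>" by (rule unit_in_norm_group[OF assms])
  then obtain p q where pq: "-1 = p\<^sup>2 - q\<^sup>2 * \<theta>" using norm_group_iff[of "-1" \<theta>] by auto
  have "q\<^sup>2 * \<theta> - p\<^sup>2 = - (p\<^sup>2 - q\<^sup>2 * \<theta>)" by simp
  also have "\<dots> = 1" unfolding pq[symmetric] by simp
  finally show ?thesis unfolding inverting_def by blast
qed

end

context char_field
begin

text \<open>On z \<surd>\<theta>, of depth ord z, the pairing is 2\<beta>z\<theta>, of valuation ord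
  \<beta> + ord z. The character must be trivial for all integers ord z > -\<rho>, which means
  -\<rho> is at least d - ord \<beta> - 1; the strict inequality produces the 1.\<close>

lemma dual_depth_eq:
  assumes \<beta>: "\<beta> \<noteq> 0" and \<theta>: "\<theta> \<in> shell ord 0"
  shows "dual_depth ord \<Phi> \<theta> (dual_of (lie_elt \<beta> \<theta>)) = of_int (ord \<beta> + 1 - d)"
  unfolding dual_depth_def
proof (rule Greatest_equality)
  have \<theta>0: "\<theta> \<noteq> 0" "ord \<theta> = 0" using \<theta> by (auto simp: shell_def)
  have depth: "depth ord \<theta> (lie_elt z \<theta>) = ereal (of_int (ord z))" if "z \<noteq> 0" for z
    using that \<theta>0 by (simp add: depth_def lie_elt_def ord_mult ord_power2)
  have ord2: "ord (2 * (\<beta> * z) * \<theta>) = ord \<beta> + ord z" "2 * (\<beta> * z) * \<theta> \<noteq> 0" if "z \<noteq> 0" for z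
    using that \<beta> \<theta>0 two_unit by (simp_all add: ord_mult)
  show "\<forall>Z\<in>lie_torus \<theta>. ereal (- of_int (ord \<beta> + 1 - d)) < depth ord \<theta> Z \<longrightarrow>
      \<Phi> (dual_of (lie_elt \<beta> \<theta>) Z) = 1"
  proof (intro ballI impI)
    fix Z assume "Z \<in> lie_torus \<theta>" and Z': "ereal (- of_int (ord \<beta> + 1 - d)) < depth ord \<theta> Z"
    then obtain z where Z: "Z = lie_elt z \<theta>" by (auto simp: lie_torus_def)
    show "\<Phi> (dual_of (lie_elt \<beta> \<theta>) Z) = 1"
    proof (cases "z = 0")
      case False
      hence "- real_of_int (ord \<beta> + 1 - d) < of_int (ord z)" using Z' depth Z by simp
      hence "2 * (\<beta> * z) * \<theta> \<in> \<pp> d" using ord2[OF False] by (simp add: pp_iff)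
      thus ?thesis by (simp add: Z dual_of_lie_elt char_trivial)
    qed (simp add: Z dual_of_lie_elt)
  qed
  fix \<rho> :: real
  assume \<rho>: "\<forall>Z\<in>lie_torus \<theta>. ereal (- \<rho>) < depth ord \<theta> Z \<longrightarrow> \<Phi> (dual_of (lie_elt \<beta> \<theta>) Z) = 1"
  show "\<rho> \<le> of_int (ord \<beta> + 1 - d)"
  proof (rule ccontr)
    assume less: "\<not> ?thesis"
    obtain y where y: "y \<in> \<pp> (d - 1)" "\<Phi> y \<noteq> 1" using char_nontrivial by blast
    hence "y \<noteq> 0" by auto
    define z where "z = y / (2 * \<beta> * \<theta>)"
    have z: "2 * (\<beta> * z) * \<theta> = y" "z \<noteq> 0" using \<open>y \<noteq> 0\<close> \<beta> \<theta>0 two_unit by (simp_all add: z_def)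
    have "d - 1 \<le> ord \<beta> + ord z" using ord2[OF z(2)] y z \<open>y \<noteq> 0\<close> by (simp add: pp_iff)
    hence "- \<rho> < of_int (ord z)" using less by linarith
    hence "ereal (- \<rho>) < depth ord \<theta> (lie_elt z \<theta>)" by (simp add: depth[OF z(2)])
    moreover have "lie_elt z \<theta> \<in> lie_torus \<theta>" by (auto simp: lie_torus_def)
    ultimately have "\<Phi> (dual_of (lie_elt \<beta> \<theta>) (lie_elt z \<theta>)) = 1" using \<rho> by blast
    thus False using y(2) by (simp add: dual_of_lie_elt z(1))
  qed
qed

end

theorem theorem9p2:
  fixes ord :: "'k::{field, complete_space} \<Rightarrow> int"
    and \<mu> :: "'k measure"
    and \<Phi> :: "'k \<Rightarrow> complex"
    and \<epsilon> \<theta> \<beta> s \<theta>' :: 'k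
    and X :: "'k ^ 2 ^ 2 \<Rightarrow> 'k"
    and Y :: "'k ^ 2 ^ 2"
    and r :: real
  assumes "local_field ord"
    and "normalised_haar ord \<mu>"
    and "additive_character \<Phi>" and "\<exists>x. \<Phi> x \<noteq> 1"
    and "nonsquare_unit_lift ord \<epsilon>"
    and "\<theta> \<in> {1, \<epsilon>}" and "\<beta> \<noteq> 0" and "s \<noteq> 0" and "\<theta>' \<noteq> 0"
  defines "X \<equiv> dual_of (lie_elt \<beta> \<theta>)"
    and "Y \<equiv> lie_elt s \<theta>'"
    and "r \<equiv> - dual_depth ord \<Phi> \<theta> X"
  assumes "ereal (dual_depth ord \<Phi> \<theta> X) + depth ord \<theta>' Y \<le> 0"
    and "torus \<theta> = torus \<theta>'"
  shows "mock_fourier ord \<mu> \<Phi> \<beta> \<theta> s \<theta>' =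
    of_real (real (residue_card ord) powr (- (r + 1)) * nabs ord (disc Y) powr (- 1 / 2)) *
    gamma_factor ord \<Phi> \<theta> X Y *
    (\<Sum>\<sigma> \<in> carrier (weyl_group (torus \<theta>)). \<Phi> (weyl_coadjoint \<sigma> X Y))"
proof -
  interpret local_field ord by (rule assms(1))
  interpret haar_field ord \<mu> by unfold_locales (rule assms(2))
  obtain d where d: "\<forall>x\<in>\<pp> d. \<Phi> x = 1" "\<exists>x\<in>\<pp> (d - 1). \<Phi> x \<noteq> 1"
    using ex_conductor[OF assms(3,4)] by blast
  interpret char_field ord \<mu> \<Phi> d
    by unfold_locales (use assms(3) d in \<open>auto simp: additive_character_def\<close>)
  have \<theta>: "\<theta> \<in> shell ord 0" using assms(5,6) by (auto simp: nonsquare_unit_lift_def shell_def)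
  hence \<theta>0: "\<theta> \<noteq> 0" "ord \<theta> = 0" by (auto simp: shell_def)
  have \<theta>': "\<theta>' = \<theta>" using torus_eq_imp_eq[OF \<theta> assms(14)] by simp
  define c where "c = \<beta> * s"
  have c: "c \<noteq> 0" "ord c = ord \<beta> + ord s" using assms(7,8) by (simp_all add: c_def ord_mult)
  define m where "m = d - ord c"
  have depth: "dual_depth ord \<Phi> \<theta> X = of_int (ord \<beta> + 1 - d)"
    unfolding X_def by (rule dual_depth_eq[OF assms(7) \<theta>])
  have "depth ord \<theta>' Y = ereal (of_int (ord s))"
    using assms(8) \<theta>0 by (simp add: Y_def \<theta>' depth_def lie_elt_def ord_mult ord_power2)
  hence "real_of_int (ord \<beta> + 1 - d) + of_int (ord s) \<le> 0" using assms(13) unfolding depth by simp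
  \<comment> \<open>The 1 in the depth of the functional turns the inequality with 0 into strict
    positivity of m.\<close>
  hence m: "m \<ge> 1" unfolding m_def c(2) by linarith
  define \<gamma> :: complex where "\<gamma> = (if \<theta> = 1 then 1 else (-1) powi m)"
  have twist: "gauss (\<theta> * a) = \<gamma> * gauss a" if a: "a \<noteq> 0" "ord a = ord c" for a
    using gauss_twist[OF assms(5) a(1)] a(2) assms(6) m by (auto simp: \<gamma>_def m_def)
  have q: "real q > 0" using q_ge_2 by simp

  have "mock_fourier ord \<mu> \<Phi> \<beta> \<theta> s \<theta>' =
      \<gamma> * of_real (real q powi - m) * (\<Phi> (2 * c * \<theta>) + \<Phi> (- (2 * c * \<theta>)))"
    unfolding \<theta>' by (rule mock_fourier_eq[OF c_def c(1) _ m \<theta> twist]) (simp add: m_def)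
  moreover have "\<Phi> (2 * c * \<theta>) + \<Phi> (- (2 * c * \<theta>)) =
      (\<Sum>\<sigma> \<in> carrier (weyl_group (torus \<theta>)). \<Phi> (weyl_coadjoint \<sigma> X Y))"
  proof -
    obtain a b where ab: "a\<^sup>2 - b\<^sup>2 * \<theta> = 1" "b \<noteq> 0" using ex_torus_elt[OF \<theta>] .
    obtain w where w: "w \<in> inverting \<theta>" using ex_inverting[OF \<theta>] by blast
    show ?thesis unfolding X_def Y_def \<theta>' weyl_sum[OF two_unit(1) \<theta>0(1) ab w] c_def ..
  qed
  moreover have "gamma_factor ord \<Phi> \<theta> X Y = \<gamma>"
  proof -
    \<comment> \<open>Here r + 1 = d - ord \<beta>; the sign of ord s is immaterial because only
      parity counts.\<close>
    have "(-1 :: complex) powi (d - ord \<beta>) * (-1) powi ord s = (-1) powi (d - ord \<beta> - ord s)"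
      by (simp add: power_int_minus_left)
    moreover have "\<lfloor>- dual_depth ord \<Phi> \<theta> X\<rfloor> + 1 = d - ord \<beta>"
      unfolding depth by (simp only: of_int_minus[symmetric] floor_of_int)
    ultimately show ?thesis
      by (simp add: gamma_factor_def Let_def \<gamma>_def sgn_unram_def Y_def lie_elt_def m_def c(2) diff_diff_eq)
  qed
  moreover have "real q powr (- (r + 1)) * nabs ord (disc Y) powr (- 1 / 2) = real q powi - m"
  proof -
    \<comment> \<open>The discriminant is 4 s^2 \<theta> = u^2 \<theta>, and 2 and \<theta> are
      units, so its valuation is 2 ord s and the square root gives q^(ord s).\<close>
    define u where "u = 2 * s"
    have disc: "disc Y = u\<^sup>2 * \<theta>"
      by (simp add: disc_def Y_def lie_elt_def \<theta>' u_def power2_eq_square)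
    have "u \<noteq> 0" "ord u = ord s" unfolding u_def using assms(8) two_unit by (simp_all add: ord_mult)
    hence "disc Y \<noteq> 0" "ord (disc Y) = 2 * ord s"
      unfolding disc using \<theta>0 by (simp_all add: ord_mult ord_power2)
    hence "nabs ord (disc Y) = real q powr (- 2 * of_int (ord s))"
      using q powr_real_of_int'[of "real q" "- 2 * ord s"] by (simp add: nabs_def)
    hence "nabs ord (disc Y) powr (- 1 / 2) = real q powr (of_int (ord s))" by (simp add: powr_powr)
    moreover have "- (r + 1) = of_int (ord \<beta> - d)" by (simp add: r_def depth)
    ultimately have "real q powr (- (r + 1)) * nabs ord (disc Y) powr (- 1 / 2) =
        real q powr (of_int (ord \<beta> - d) + of_int (ord s))"
      by (simp only: powr_add)
    also have "\<dots> = real q powr of_int (- m)" by (simp add: m_def c(2) algebra_simps)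
    also have "\<dots> = real q powi - m" using q by (intro powr_real_of_int') simp_all
    finally show ?thesis .
  qed
  ultimately show ?thesis by (simp only: mult_ac)
qed

end
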